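(* Let $k\ge1$ be an integer, $\lambda,\mu>0$, $\theta>0$, $\alpha\in(0,1)$. The inter-arrival times $T^{\theta,\alpha}$ of the tempered Erlang queue $Q^{\theta,\alpha}$ are independent and identically distributed with \begin{equation*} \Pr(T^{\theta,\alpha}>t)=e^{-\theta t}\sum_{q=0}^{\infty}(\theta t)^q\sum_{r=0}^{\infty}(-\lambda t^\alpha)^rE_{\alpha, r\alpha+q+1}^r(\theta^\alpha t^\alpha),\qquad t\ge0. \end{equation*}
   Context: Erlang queue: $\{Q(t)\}_{t\ge0}$, $Q(t)=(N(t),S(t))$, with $N(t)$ the number of customers and $S(t)$ the phase of the customer in service, where customers arrive according to a Poisson process of rate $\lambda$ and service is Erlang with $k$ phases each exponential of rate $k\mu$. Let $D_{\theta,\alpha}$ be the subordinator with $\mathbb{E}e^{-sD_{\theta,\alpha}(t)}=e^{-t((s+\theta)^\alpha-\theta^\alpha)}$ and $Y_{\theta,\alpha}(t)=\inf\{x>0:D_{\theta,\alpha}(x)>t\}$, independent of $Q$; the tempered Erlang queue is $Q^{\theta,\alpha}(t)=Q(Y_{\theta,\alpha}(t))$. If $\tau_1<\tau_2<\cdots$ are the arrival epochs of the underlying queue, the $n$-th arrival of $Q^{\theta,\alpha}$ occurs at time $T_n=\inf\{t\ge0: Y_{\theta,\alpha}(t)\ge\tau_n\}$, and the inter-arrival times are $T_n-T_{n-1}$ ($T_0=0$). Three-parameter Mittag-Leffler function: $E_{\alpha,b}^{\gamma}(x)=\sum_{j\ge0}\frac{(\gamma)_j x^j}{j!\Gamma(\alpha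 j+b)}$ with Pochhammer symbol $(\gamma)_j=\gamma(\gamma+1)\cdots(\gamma+j-1)$, $(\gamma)_0=1$ (so $E^0_{\alpha,b}(x)=1/\Gamma(b)$). *)

theory Defs
  imports "HOL-Probability.Probability"
begin

definition ML3 :: "real \<Rightarrow> real \<Rightarrow> real \<Rightarrow> real \<Rightarrow> real" where
  "ML3 a b g x = (\<Sum>j. pochhammer g j * x ^ j / (fact j * Gamma (a * real j + b)))"

definition tempered_stable_subordinator ::
  "'a measure \<Rightarrow> real \<Rightarrow> real \<Rightarrow> (real \<Rightarrow> 'a \<Rightarrow> real) \<Rightarrow> bool" where
  "tempered_stable_subordinator M \<theta> \<alpha> D \<longleftrightarrow>
     (\<forall>x\<ge>0. D x \<in> borel_measurable M) \<and>
     (\<forall>\<omega>\<in>space M. D 0 \<omega> = 0 \<and> mono_on {0..} (\<lambda>x. D x \<omega>) \<and>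
         (\<forall>x\<ge>0. continuous (at_right x) (\<lambda>y. D y \<omega>))) \<and>
     (\<forall>(n::nat) (s::nat \<Rightarrow> real). 0 \<le> s 0 \<and> (\<forall>i. s i \<le> s (Suc i)) \<longrightarrow>
         prob_space.indep_vars M (\<lambda>_. borel) (\<lambda>i \<omega>. D (s (Suc i)) \<omega> - D (s i) \<omega>) {..<n}) \<and>
     (\<forall>s h. 0 \<le> s \<longrightarrow> 0 \<le> h \<longrightarrow>
         distr M borel (\<lambda>\<omega>. D (s + h) \<omega> - D s \<omega>) = distr M borel (D h)) \<and>
     (\<forall>s t. 0 \<le> s \<longrightarrow> 0 \<le> t \<longrightarrow>
         integral\<^sup>L M (\<lambda>\<omega>. exp (- s * D t \<omega>)) = exp (- t * ((s + \<theta>) powr \<alpha> - \<theta> powr \<alpha>)))"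

definition inv_sub :: "(real \<Rightarrow> 'a \<Rightarrow> real) \<Rightarrow> real \<Rightarrow> 'a \<Rightarrow> real" where
  "inv_sub D t \<omega> = Inf {x. 0 < x \<and> t < D x \<omega>}"

text \<open>Arrival epochs of the underlying queue: tau_n = E_0 + ... + E_{n-1},
  where the E_i are the (Poisson) exponential inter-arrival times.\<close>
definition arrival_epoch :: "(nat \<Rightarrow> 'a \<Rightarrow> real) \<Rightarrow> nat \<Rightarrow> 'a \<Rightarrow> real" where
  "arrival_epoch E n \<omega> = (\<Sum>i<n. E i \<omega>)"

definition tc_arrival_time ::
  "(real \<Rightarrow> 'a \<Rightarrow> real) \<Rightarrow> (nat \<Rightarrow> 'a \<Rightarrow> real) \<Rightarrow> nat \<Rightarrow> 'a \<Rightarrow> real" where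
  "tc_arrival_time D E n \<omega> =
     (if n = 0 then 0 else Inf {t. 0 \<le> t \<and> arrival_epoch E n \<omega> \<le> inv_sub D t \<omega>})"

definition tc_interarrival ::
  "(real \<Rightarrow> 'a \<Rightarrow> real) \<Rightarrow> (nat \<Rightarrow> 'a \<Rightarrow> real) \<Rightarrow> nat \<Rightarrow> 'a \<Rightarrow> real" where
  "tc_interarrival D E n \<omega> = tc_arrival_time D E (Suc n) \<omega> - tc_arrival_time D E n \<omega>"

end

theory Submission
  imports Defs
begin

text \<open>
  Almost surely the \<open>n\<close>-th arrival happens at \<open>D(\<tau>\<^sub>n-) = D(\<tau>\<^sub>n)\<close>, where \<open>\<tau>\<^sub>n\<close> are the arrival epochs of
  the underlying queue. Conditionally on these epochs the inter-arrival times are thus increments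
  of a process with independent stationary increments over i.i.d. exponential time spans, hence
  i.i.d. with Laplace transform \<open>lam / (lam + \<psi>(s))\<close>, where \<open>\<psi>(s) = (s + \<theta>)\<^sup>\<alpha> - \<theta>\<^sup>\<alpha>\<close>. The Laplace transform of the
  tail is therefore \<open>\<psi>(s) / (s (lam + \<psi>(s)))\<close>; in terms of \<open>u = s + \<theta>\<close>, expanding \<open>1 / (u - \<theta>)\<close>,
  \<open>1 / (1 + lam / (u\<^sup>\<alpha> - \<theta>\<^sup>\<alpha>))\<close> and \<open>(u\<^sup>\<alpha> - \<theta>\<^sup>\<alpha>)\<^sup>-\<^sup>r\<close> into power series and inverting term by term gives the
  series in the statement for large \<open>s\<close>, and Lerch's uniqueness theorem concludes.
\<close>

section \<open>Laplace transforms of series of Mittag-Leffler functions\<close>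

text \<open>Large arguments are forced by absolute convergence: the series in \<open>r\<close> needs
  \<open>lam < u powr \<alpha> - \<theta> powr \<alpha>\<close>. This costs nothing, because
  uniqueness needs the transforms only along an arithmetic progression. The shift from
  \<open>s\<close> to \<open>u = s + \<theta>\<close> is what produces the factor
  \<open>exp (- \<theta> * t)\<close>. On the probabilistic side there are two obstacles. The
  equality of \<open>D\<close> and its left limit holds almost surely only at a fixed time, with a
  null set depending on that time; independence of \<open>D\<close> and \<open>E\<close> is what
  carries it over to the random epochs. Moreover, both infima defining an arrival time may be taken
  over the empty set on bounded paths. These paths form a null set, but independence and equality of
  laws presuppose measurability on the whole sample space, so the arrival times are computed on
  every path, exceptional ones included.\<close>

text \<open>The exponential bound by a fixed multiple of \<open>exp (w * t)\<close>, rather than mere integrability,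
  is what makes this notion closed under countable sums (\<open>laplace_dom_suminf\<close>).\<close>

definition laplace_dom :: "real \<Rightarrow> (real \<Rightarrow> real) \<Rightarrow> real \<Rightarrow> (real \<Rightarrow> real) \<Rightarrow> bool" where
  "laplace_dom w f b \<Phi> \<longleftrightarrow> continuous_on {0..} f \<and> (\<forall>t\<ge>0. \<bar>f t\<bar> \<le> b * exp (w * t)) \<and>
     (\<forall>u>w. (LINT t:{0..}|lborel. exp (- u * t) * f t) = \<Phi> u)"

text \<open>Euler's integral for \<open>Gamma\<close> after the substitution
  \<open>t \<mapsto> u * t\<close>.\<close>

lemma has_bochner_integral_laplace_powr:
  fixes u \<beta> :: real
  assumes "u > 0" "\<beta> > -1"
  shows "has_bochner_integral lborel (\<lambda>t. indicator {0..} t * (exp (- u * t) * t powr \<beta>))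
           (Gamma (\<beta> + 1) / u powr (\<beta> + 1))"
proof -
  have G: "Gamma (\<beta> + 1) > 0"
    using assms by (intro Gamma_real_pos) auto
  have "has_bochner_integral lborel (\<lambda>t. indicator {0..} t * t powr \<beta> / exp t) (Gamma (\<beta> + 1))"
  proof (rule has_bochner_integral_nn_integral)
    show "(\<integral>\<^sup>+ x. ennreal (indicator {0..} x * x powr \<beta> / exp x) \<partial>lborel) = ennreal (Gamma (\<beta> + 1))"
      using assms by (subst Gamma_conv_nn_integral_real) auto
  qed (use G in auto)
  then have "has_bochner_integral lborel (\<lambda>t. indicator {0..} (0 + u * t) * (0 + u * t) powr \<beta> / exp (0 + u * t))
      (Gamma (\<beta> + 1) /\<^sub>R \<bar>u\<bar>)"
    using assms by (subst (asm) lborel_has_bochner_integral_real_affine_iff[of u _ _ 0]) auto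
  then have "has_bochner_integral lborel (\<lambda>t. inverse (u powr \<beta>) *
       (indicator {0..} (0 + u * t) * (0 + u * t) powr \<beta> / exp (0 + u * t)))
      (inverse (u powr \<beta>) * (Gamma (\<beta> + 1) /\<^sub>R \<bar>u\<bar>))"
    by (intro has_bochner_integral_mult_right) auto
  also have "(\<lambda>t. inverse (u powr \<beta>) *
       (indicator {0..} (0 + u * t) * (0 + u * t) powr \<beta> / exp (0 + u * t))) =
     (\<lambda>t. indicator {0..} t * (exp (- u * t) * t powr \<beta>))"
    using assms by (auto simp: fun_eq_iff indicator_def powr_mult exp_minus field_simps zero_le_mult_iff)
  also have "inverse (u powr \<beta>) * (Gamma (\<beta> + 1) /\<^sub>R \<bar>u\<bar>) = Gamma (\<beta> + 1) / u powr (\<beta> + 1)"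
    using assms by (simp add: powr_add field_simps)
  finally show ?thesis .
qed

text \<open>Restrict the Gamma integral to \<open>s \<ge> t\<close>: there
  \<open>s powr \<beta> \<ge> t powr \<beta>\<close>, and the exponential density has mass
  \<open>exp (- t)\<close>. This is the source of the constants in
  \<open>laplace_dom_power\<close>.\<close>

lemma powr_le_Gamma_exp:
  fixes t \<beta> :: real
  assumes "t \<ge> 0" "\<beta> \<ge> 0"
  shows "t powr \<beta> * exp (- t) \<le> Gamma (\<beta> + 1)"
proof -
  note I = has_bochner_integral_laplace_powr[of 1 \<beta>]
  have I': "has_bochner_integral lborel (\<lambda>s. indicator {0..} s * (exp (- 1 * s) * s powr 0)) (1::real)"
    using has_bochner_integral_laplace_powr[of 1 0] by simp
  have "has_bochner_integral lborel (\<lambda>s. indicator {0..} (- t + 1 * s) * (exp (- 1 * (- t + 1 * s)) * (- t + 1 * s) powr 0)) (1::real)"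
    using lborel_has_bochner_integral_real_affine_iff[THEN iffD1, of 1 _ _ "-t", OF _ I'] by simp
  then have J: "has_bochner_integral lborel (\<lambda>s. (t powr \<beta> * exp (-t)) * (indicator {0..} (- t + 1 * s) * (exp (- 1 * (- t + 1 * s)) * (- t + 1 * s) powr 0)))
      (t powr \<beta> * exp (-t) * 1)"
    by (intro has_bochner_integral_mult_right) auto
  have "t powr \<beta> * exp (-t) * 1 \<le> Gamma (\<beta> + 1) / 1 powr (\<beta> + 1)"
    unfolding has_bochner_integral_integral_eq[OF J, symmetric]
  proof (subst has_bochner_integral_integral_eq[OF I, symmetric],
      (use assms in simp_all)[2], rule integral_mono[OF integrable.intros[OF J] integrable.intros[OF I]])
    fix s :: real
    show "t powr \<beta> * exp (-t) * (indicator {0..} (- t + 1 * s) * (exp (- 1 * (- t + 1 * s)) * (- t + 1 * s) powr 0))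
      \<le> indicator {0..} s * (exp (- 1 * s) * s powr \<beta>)"
    proof (cases "t \<le> s")
      case True
      then have "t powr \<beta> * exp (- s) \<le> s powr \<beta> * exp (- s)"
        using assms by (intro mult_right_mono powr_mono2) auto
      moreover have "t powr \<beta> * exp (- t) * exp (- 1 * (- t + 1 * s)) = t powr \<beta> * exp (- s)"
        by (simp add: mult.assoc mult_exp_exp)
      ultimately have "t powr \<beta> * exp (- t) * (exp (- 1 * (- t + 1 * s))) \<le> exp (- s) * s powr \<beta>"
        by (simp only: mult_ac)
      then show ?thesis
        using True assms by (auto simp: indicator_def)
    qed (auto simp: indicator_def)
  qed (use assms in auto)
  then show ?thesis by simp
qed

lemma laplace_exp:
  fixes c :: real
  assumes "c > 0"
  shows "set_integrable lborel {0..} (\<lambda>t. exp (- c * t))"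
    and "(LINT t:{0..}|lborel. exp (- c * t)) = 1 / c"
proof -
  have "has_bochner_integral lborel (\<lambda>t. indicator {0..} t * (exp (- c * t) * t powr 0)) (1 / c)"
    using has_bochner_integral_laplace_powr[of c 0] assms by simp
  \<comment> \<open>Since \<open>0 powr 0 = 0\<close>, the integrands with and without
    \<open>t powr 0\<close> agree only off the origin.\<close>
  moreover have "AE t::real in lborel. t \<noteq> 0"
    by (rule AE_lborel_singleton)
  then have "AE t in lborel. indicator {0..} t * (exp (- c * t) * t powr 0) = indicator {0..} t *\<^sub>R exp (- c * t)"
    by eventually_elim auto
  ultimately have "has_bochner_integral lborel (\<lambda>t. indicator {0..} t *\<^sub>R exp (- c * t)) (1 / c)"
    by (subst (asm) has_bochner_integral_cong_AE) auto
  then show "set_integrable lborel {0..} (\<lambda>t. exp (- c * t))" "(LINT t:{0..}|lborel. exp (- c * t)) = 1 / c"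
    by (auto simp: set_integrable_def set_lebesgue_integral_def has_bochner_integral_iff)
qed

text \<open>Domination by \<open>b * exp (- (u - w) * t)\<close>. The bound on the \<open>L1\<close>
  norm is linear in \<open>b\<close>, so summable bounds yield summable norms in
  \<open>laplace_dom_suminf\<close>.\<close>

lemma set_integrable_exp_bound:
  fixes f :: "real \<Rightarrow> real"
  assumes m: "set_borel_measurable lborel {0..} f"
    and b: "\<And>t. t \<ge> 0 \<Longrightarrow> \<bar>f t\<bar> \<le> b * exp (w * t)" and u: "w < u"
  shows "set_integrable lborel {0..} (\<lambda>t. exp (- u * t) * f t)"
    and "(LINT t:{0..}|lborel. \<bar>exp (- u * t) * f t\<bar>) \<le> b / (u - w)"
proof -
  have i: "set_integrable lborel {0..} (\<lambda>t. b * exp (- (u - w) * t))"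
    using laplace_exp(1)[of "u - w"] u by auto
  have le: "\<bar>exp (- u * t) * f t\<bar> \<le> b * exp (- (u - w) * t)" if "t \<ge> 0" for t
  proof -
    have "\<bar>exp (- u * t) * f t\<bar> \<le> exp (- u * t) * (b * exp (w * t))"
      using b[OF that] by (simp add: abs_mult)
    also have "\<dots> = b * exp (- (u - w) * t)"
      by (simp add: algebra_simps mult_exp_exp)
    finally show ?thesis .
  qed
  have "set_borel_measurable lborel {0..} (\<lambda>t. exp (- u * t) * f t)"
  proof -
    have "(\<lambda>t. exp (- u * t) * (indicator {0..} t *\<^sub>R f t)) \<in> borel_measurable lborel"
      using m unfolding set_borel_measurable_def by measurable
    then show ?thesis
      unfolding set_borel_measurable_def by (simp add: mult_ac)
  qed
  then show s: "set_integrable lborel {0..} (\<lambda>t. exp (- u * t) * f t)"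
    by (rule set_integrable_bound[OF i]) (use order_trans[OF le abs_ge_self] in \<open>auto intro!: AE_I2\<close>)
  have "(LINT t:{0..}|lborel. \<bar>exp (- u * t) * f t\<bar>) \<le> (LINT t:{0..}|lborel. b * exp (- (u - w) * t))"
    using s le by (intro set_integral_mono set_integrable_abs i) auto
  also have "\<dots> = b / (u - w)"
    using u laplace_exp(2)[of "u - w"] by simp
  finally show "(LINT t:{0..}|lborel. \<bar>exp (- u * t) * f t\<bar>) \<le> b / (u - w)" .
qed

lemma laplace_dom_measurable:
  "laplace_dom w f b \<Phi> \<Longrightarrow> set_borel_measurable lborel {0..} f"
  using borel_measurable_continuous_on_indicator[of "{0::real..}" f]
  unfolding laplace_dom_def set_borel_measurable_def by simp

section \<open>Closure under scaling and countable sums\<close>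

lemma laplace_dom_cong:
  assumes "laplace_dom w f b \<Phi>" "\<And>t. t \<ge> 0 \<Longrightarrow> f t = g t" "b = b'" "\<And>u. u > w \<Longrightarrow> \<Phi> u = \<Psi> u"
  shows "laplace_dom w g b' \<Psi>"
proof -
  have "continuous_on {0..} g" if "continuous_on {0..} f"
    using that assms(2) by (subst continuous_on_cong[OF refl, of _ _ f]) auto
  moreover have "(LINT t:{0..}|lborel. exp (- u * t) * g t) = (LINT t:{0..}|lborel. exp (- u * t) * f t)" for u
    using assms(2) by (intro set_lebesgue_integral_cong) auto
  ultimately show ?thesis
    using assms unfolding laplace_dom_def by auto
qed

lemma laplace_dom_cmult:
  assumes "laplace_dom w f b \<Phi>"
  shows "laplace_dom w (\<lambda>t. c * f t) (\<bar>c\<bar> * b) (\<lambda>u. c * \<Phi> u)"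
proof -
  have "(LINT t:{0..}|lborel. exp (- u * t) * (c * f t)) = c * (LINT t:{0..}|lborel. exp (- u * t) * f t)" for u
    by (subst set_integral_mult_right[symmetric]) (simp add: mult_ac)
  then show ?thesis
    using assms unfolding laplace_dom_def
    by (auto intro!: continuous_intros simp: abs_mult mult.assoc mult_left_mono)
qed

text \<open>Summability of the bounds does everything: it gives uniform convergence after damping,
  hence continuity, it adds up to the new exponential bound, and through the norms
  \<open>b i / (u - w)\<close> it permits exchanging sum and integral for each
  \<open>u > w\<close>.\<close>

lemma laplace_dom_suminf:
  assumes L: "\<And>i::nat. laplace_dom w (f i) (b i) (\<Phi> i)" and s: "b sums B"
  shows "laplace_dom w (\<lambda>t. \<Sum>i. f i t) B (\<lambda>u. \<Sum>i. \<Phi> i u)"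
    and "t \<ge> 0 \<Longrightarrow> summable (\<lambda>i. f i t)"
proof -
  have bd: "\<bar>f i t\<bar> \<le> b i * exp (w * t)" if "t \<ge> 0" for i t
    using L that unfolding laplace_dom_def by auto
  have b0: "b i \<ge> 0" for i
    using bd[of 0 i] by simp
  have sb: "summable b" and B: "B = suminf b" using s by (auto simp: sums_iff)
  have sm: "summable (\<lambda>i. \<bar>f i t\<bar>)" if "t \<ge> 0" for t
    by (rule summable_comparison_test'[where g = "\<lambda>i. b i * exp (w * t)" and N = 0])
       (use bd[OF that] sb in \<open>auto intro: summable_mult2\<close>)
  show sm': "t \<ge> 0 \<Longrightarrow> summable (\<lambda>i. f i t)" for t
    using sm by (rule summable_rabs_cancel)
  \<comment> \<open>Only the damped terms are bounded by \<open>b i\<close> uniformly on the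
    half-line; the factor is undone afterwards.\<close>
  have "continuous_on {0..} (\<lambda>t. \<Sum>i. exp (- w * t) * f i t)"
  proof (rule uniform_limit_theorem[OF _ Weierstrass_m_test])
    show "\<forall>\<^sub>F n in sequentially. continuous_on {0..} (\<lambda>t. \<Sum>i<n. exp (- w * t) * f i t)"
      using L unfolding laplace_dom_def by (intro always_eventually allI continuous_intros) auto
    show "norm (exp (- w * t) * f i t) \<le> b i" if "t \<in> {0..}" for i t
      using bd[of t i] that by (simp add: abs_mult exp_minus field_simps)
  qed (use sb in auto)
  then have "continuous_on {0..} (\<lambda>t. exp (w * t) * (\<Sum>i. exp (- w * t) * f i t))"
    by (intro continuous_intros)
  also have "?this \<longleftrightarrow> continuous_on {0..} (\<lambda>t. \<Sum>i. f i t)"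
  proof (intro continuous_on_cong refl)
    fix t :: real assume "t \<in> {0..}"
    then have "(\<Sum>i. exp (- w * t) * f i t) = exp (- w * t) * (\<Sum>i. f i t)"
      using sm' by (intro suminf_mult) auto
    then show "exp (w * t) * (\<Sum>i. exp (- w * t) * f i t) = (\<Sum>i. f i t)"
      by (simp add: exp_minus)
  qed
  finally have c: "continuous_on {0..} (\<lambda>t. \<Sum>i. f i t)" .
  have bd': "\<bar>\<Sum>i. f i t\<bar> \<le> B * exp (w * t)" if t: "t \<ge> 0" for t
  proof -
    have "\<bar>\<Sum>i. f i t\<bar> \<le> (\<Sum>i. \<bar>f i t\<bar>)"
      using sm[OF t] by (rule summable_rabs)
    also have "\<dots> \<le> (\<Sum>i. b i * exp (w * t))"
      using bd[OF t] sm[OF t] sb by (intro suminf_le summable_mult2) auto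
    also have "\<dots> = B * exp (w * t)"
      using sb B by (simp add: suminf_mult2)
    finally show ?thesis .
  qed
  have "(LINT t:{0..}|lborel. exp (- u * t) * (\<Sum>i. f i t)) = (\<Sum>i. \<Phi> i u)" if u: "u > w" for u
  proof -
    define F where "F i t = indicator {0..} t *\<^sub>R (exp (- u * t) * f i t)" for i and t :: real
    note I = set_integrable_exp_bound[OF laplace_dom_measurable[OF L] bd u]
    have "(LINT t|lborel. (\<Sum>i. F i t)) = (\<Sum>i. integral\<^sup>L lborel (F i))"
    proof (rule integral_suminf)
      show "integrable lborel (F i)" for i
        using I(1)[of i] unfolding F_def set_integrable_def by simp
      show "AE x in lborel. summable (\<lambda>i. norm (F i x))"
      proof (rule AE_I2)
        fix x :: real
        show "summable (\<lambda>i. norm (F i x))"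
          using sm[of x] by (cases "x \<ge> 0") (auto simp: F_def abs_mult intro!: summable_mult)
      qed
      have eq: "(LINT x|lborel. norm (F i x)) = (LINT t:{0..}|lborel. \<bar>exp (- u * t) * f i t\<bar>)" for i
        unfolding F_def set_lebesgue_integral_def
        by (intro Bochner_Integration.integral_cong) (auto simp: indicator_def)
      show "summable (\<lambda>i. LINT x|lborel. norm (F i x))"
      proof (rule summable_comparison_test'[where g = "\<lambda>i. b i / (u - w)" and N = 0])
        show "summable (\<lambda>i. b i / (u - w))" using sb by (rule summable_divide)
        show "norm (LINT x|lborel. norm (F i x)) \<le> b i / (u - w)" for i
          using I(2)[of i] eq[of i] Bochner_Integration.integral_nonneg[of lborel "\<lambda>x. norm (F i x)"] by auto
      qed
    qed
    moreover have "integral\<^sup>L lborel (F i) = \<Phi> i u" for i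
      using L[of i] u unfolding laplace_dom_def F_def set_lebesgue_integral_def by auto
    moreover have "(\<Sum>i. F i t) = indicator {0..} t *\<^sub>R (exp (- u * t) * (\<Sum>i. f i t))" for t
      using sm'[of t] by (cases "t \<ge> 0") (auto simp: F_def intro!: suminf_mult)
    ultimately show ?thesis
      unfolding set_lebesgue_integral_def by simp
  qed
  with c bd' show "laplace_dom w (\<lambda>t. \<Sum>i. f i t) B (\<lambda>u. \<Sum>i. \<Phi> i u)"
    unfolding laplace_dom_def by auto
qed


section \<open>Termwise transforms up to the tail series\<close>

lemma suminf_cmult_real:
  fixes c :: real
  assumes "summable (\<lambda>n. c * f n)"
  shows "(\<Sum>n. c * f n) = c * (\<Sum>n. f n)"
  \<comment> \<open>For \<open>c = 0\<close> nothing is known about \<open>f\<close>, but both sides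
    vanish. This occurs at \<open>t = 0\<close>, where the prefactor pulled out of a series may be
    zero.\<close>
  using assms by (cases "c = 0") (auto intro: suminf_mult)

text \<open>The binomial series with exponent \<open>- r\<close>; the signs of the generalized
  binomial coefficient and of \<open>- x\<close> cancel.\<close>

lemma pochhammer_series:
  fixes x :: real
  assumes "\<bar>x\<bar> < 1"
  shows "(\<lambda>j. pochhammer (real r) j / fact j * x ^ j) sums (1 / (1 - x) ^ r)"
proof -
  have "(\<lambda>j. (- real r gchoose j) * (- x) ^ j) sums (1 + (- x)) powr (- real r)"
    using assms by (intro gen_binomial_real) auto
  also have "(1 + (- x)) powr (- real r) = 1 / (1 - x) ^ r"
    using assms by (simp add: powr_minus powr_realpow divide_inverse)
  also have "(\<lambda>j. (- real r gchoose j) * (- x) ^ j) = (\<lambda>j. pochhammer (real r) j / fact j * x ^ j)"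
  proof
    fix j
    have "(- real r gchoose j) * (- x) ^ j = ((- 1) ^ j * (- 1) ^ j) * (pochhammer (real r) j / fact j * x ^ j)"
      by (simp add: gbinomial_pochhammer power_minus[of x])
    then show "(- real r gchoose j) * (- x) ^ j = pochhammer (real r) j / fact j * x ^ j"
      by (simp flip: power_mult_distrib)
  qed
  finally show ?thesis .
qed

text \<open>The monomial is split into \<open>t ^ q\<close> and \<open>(t powr \<alpha>) ^ n\<close> because \<open>0 powr 0 = 0\<close>
  would break continuity at \<open>0\<close>.\<close>

lemma laplace_dom_power:
  fixes w \<alpha> :: real
  assumes "w > 0" "\<alpha> > 0"
  shows "laplace_dom w (\<lambda>t. t ^ q * (t powr \<alpha>) ^ n / Gamma (\<alpha> * real n + real q + 1))
           (1 / (w ^ q * (w powr \<alpha>) ^ n)) (\<lambda>u. 1 / (u ^ Suc q * (u powr \<alpha>) ^ n))"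
proof -
  define \<beta> where "\<beta> = \<alpha> * real n + real q"
  have \<beta>: "\<beta> \<ge> 0" using assms by (simp add: \<beta>_def)
  then have G: "Gamma (\<beta> + 1) > 0" by (intro Gamma_real_pos) auto
  have pw: "t ^ q * (t powr \<alpha>) ^ n = t powr \<beta>" if "t > 0" for t :: real
    using that by (simp add: \<beta>_def powr_add powr_power powr_realpow mult_ac)
  have "\<bar>t ^ q * (t powr \<alpha>) ^ n / Gamma (\<beta> + 1)\<bar> \<le> 1 / (w ^ q * (w powr \<alpha>) ^ n) * exp (w * t)" if t: "t \<ge> 0" for t
  proof (cases "t = 0")
    case True
    then show ?thesis using assms by (cases "n = 0"; cases "q = 0") (auto simp: \<beta>_def zero_power)
  next
    case False
    with t have t: "t > 0" by simp
    \<comment> \<open>Rescaling time by \<open>w\<close> leaves the constant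
      \<open>1 / w powr \<beta>\<close>, which is \<open>w\<close> times the transform at
      \<open>w\<close>. Bounds and transforms thus have the same form and can be summed
      alike.\<close>
    have "(w * t) powr \<beta> * exp (- (w * t)) \<le> Gamma (\<beta> + 1)"
      using t assms \<beta> by (intro powr_le_Gamma_exp) auto
    then have "w powr \<beta> * t powr \<beta> \<le> Gamma (\<beta> + 1) * exp (w * t)"
      using t assms by (simp add: powr_mult exp_minus field_simps)
    then have "t powr \<beta> / Gamma (\<beta> + 1) \<le> 1 / w powr \<beta> * exp (w * t)"
      using G assms by (simp add: field_simps)
    then show ?thesis
      using pw[OF t] pw[of w] assms G by simp
  qed
  moreover have "continuous_on {0..} (\<lambda>t. t ^ q * (t powr \<alpha>) ^ n / Gamma (\<beta> + 1))"
    using assms G by (intro continuous_intros continuous_on_powr') auto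
  moreover have "(LINT t:{0..}|lborel. exp (- u * t) * (t ^ q * (t powr \<alpha>) ^ n / Gamma (\<beta> + 1)))
      = 1 / (u ^ Suc q * (u powr \<alpha>) ^ n)" if "u > w" for u
  proof -
    have u: "u > 0" using that assms by auto
    have "AE t::real in lborel. t \<noteq> 0"
      by (rule AE_lborel_singleton)
    then have "(LINT t:{0..}|lborel. exp (- u * t) * (t ^ q * (t powr \<alpha>) ^ n / Gamma (\<beta> + 1))) =
       (LINT t|lborel. indicator {0..} t * (exp (- u * t) * t powr \<beta>) / Gamma (\<beta> + 1))"
      unfolding set_lebesgue_integral_def
      by (intro integral_cong_AE) (auto elim!: eventually_mono simp: pw indicator_def)
    also have "\<dots> = (Gamma (\<beta> + 1) / u powr (\<beta> + 1)) / Gamma (\<beta> + 1)"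
      using has_bochner_integral_integral_eq[OF has_bochner_integral_laplace_powr[OF u, of \<beta>]] \<beta>
      by simp
    also have "\<dots> = 1 / u powr (\<beta> + 1)"
      using G by simp
    also have "\<dots> = 1 / (u ^ Suc q * (u powr \<alpha>) ^ n)"
      using u by (simp add: powr_add pw[symmetric])
    finally show ?thesis .
  qed
  ultimately show ?thesis
    unfolding laplace_dom_def \<beta>_def by auto
qed

text \<open>The prefactor makes the \<open>j\<close>-th term of the series a multiple of
  \<open>t powr (\<alpha> * (r + j) + q)\<close> for \<open>t > 0\<close>, with exactly the matching
  Gamma value below it. The termwise transforms form a binomial series in
  \<open>c / u powr \<alpha>\<close>.\<close>

lemma laplace_dom_ML3:
  fixes w \<alpha> c :: real
  assumes "w > 0" "\<alpha> > 0" "c \<ge> 0" "c < w powr \<alpha>"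
  shows "laplace_dom w
           (\<lambda>t. t ^ q * (t powr \<alpha>) ^ r * ML3 \<alpha> (real r * \<alpha> + real q + 1) (real r) (c * t powr \<alpha>))
           (1 / (w ^ q * (w powr \<alpha> - c) ^ r)) (\<lambda>u. 1 / (u ^ Suc q * (u powr \<alpha> - c) ^ r))"
proof -
  define p where "p j = pochhammer (real r) j / fact j * c ^ j" for j
  define A where "A n t = t ^ q * (t powr \<alpha>) ^ n / Gamma (\<alpha> * real n + real q + 1)" for n t
  \<comment> \<open>Nonnegative coefficients allow the bounds to be summed in closed form, without
    absolute values.\<close>
  have p0: "p j \<ge> 0" for j
    using assms unfolding p_def by (cases "r = 0"; cases "j = 0")
      (auto simp: pochhammer_0_left intro!: mult_nonneg_nonneg divide_nonneg_nonneg less_imp_le[OF pochhammer_pos])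
  \<comment> \<open>Used with \<open>v = w ^ q\<close> and \<open>W = w powr \<alpha>\<close> for
    the bounds, and with \<open>v = u ^ Suc q\<close> and \<open>W = u powr \<alpha>\<close> for the
    transforms.\<close>
  have S: "(\<lambda>j. p j * (1 / (v * W ^ (r + j)))) sums (1 / (v * (W - c) ^ r))" if "W > c" "v > 0" for W v :: real
  proof -
    have "(\<lambda>j. (1 / (v * W ^ r)) * (pochhammer (real r) j / fact j * (c / W) ^ j)) sums ((1 / (v * W ^ r)) * (1 / (1 - c / W) ^ r))"
      using that assms by (intro sums_mult pochhammer_series) auto
    also have "(1 / (v * W ^ r)) * (1 / (1 - c / W) ^ r) = 1 / (v * (W - c) ^ r)"
    proof -
      have "W ^ r * (1 - c / W) ^ r = (W - c) ^ r"
        using that assms by (simp only: power_mult_distrib[symmetric]) (simp add: right_diff_distrib)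
      then show ?thesis by (simp add: mult.assoc)
    qed
    also have "(\<lambda>j. (1 / (v * W ^ r)) * (pochhammer (real r) j / fact j * (c / W) ^ j)) = (\<lambda>j. p j * (1 / (v * W ^ (r + j))))"
      by (intro ext) (simp add: p_def power_add power_divide mult.assoc)
    finally show ?thesis .
  qed
  have L: "laplace_dom w (\<lambda>t. p j * A (r + j) t) (p j * (1 / (w ^ q * (w powr \<alpha>) ^ (r + j))))
      (\<lambda>u. p j * (1 / (u ^ Suc q * (u powr \<alpha>) ^ (r + j))))" for j
    using laplace_dom_cmult[OF laplace_dom_power[OF assms(1,2)], of "p j" q "r + j"]
    unfolding A_def abs_of_nonneg[OF p0] .
  note LS = laplace_dom_suminf[of w "\<lambda>j t. p j * A (r + j) t", OF L S]
  show ?thesis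
  proof (rule laplace_dom_cong[OF LS(1)])
    fix t :: real assume t: "t \<ge> 0"
    define g where "g j = pochhammer (real r) j * (c * t powr \<alpha>) ^ j / (fact j * Gamma (\<alpha> * real j + (real r * \<alpha> + real q + 1)))" for j
    have eq: "p j * A (r + j) t = (t ^ q * (t powr \<alpha>) ^ r) * g j" for j
    proof -
      have "\<alpha> * real (r + j) + real q + 1 = \<alpha> * real j + (real r * \<alpha> + real q + 1)"
        by (simp add: algebra_simps)
      then show ?thesis
        by (simp add: p_def A_def g_def power_add power_mult_distrib add.assoc mult_ac)
    qed
    have "summable (\<lambda>j. p j * A (r + j) t)"
      using assms t by (intro LS(2)) auto
    then show "(\<Sum>j. p j * A (r + j) t) = t ^ q * (t powr \<alpha>) ^ r * ML3 \<alpha> (real r * \<alpha> + real q + 1) (real r) (c * t powr \<alpha>)"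
      unfolding eq ML3_def g_def[symmetric] by (rule suminf_cmult_real)
  next
    fix u assume u: "w < u"
    have "c < u powr \<alpha>"
      using assms u powr_less_mono2[of \<alpha> w u] by auto
    then show "(\<Sum>j. p j * (1 / (u ^ Suc q * (u powr \<alpha>) ^ (r + j)))) = 1 / (u ^ Suc q * (u powr \<alpha> - c) ^ r)"
      using S[of "u powr \<alpha>" "u ^ Suc q"] u assms by (auto simp: sums_iff)
  qed (use assms in auto)
qed

text \<open>The claimed tail without its factor \<open>exp (- \<theta> * t)\<close>, so that the
  Laplace variable is \<open>u = s + \<theta>\<close>.\<close>

definition tail_series :: "real \<Rightarrow> real \<Rightarrow> real \<Rightarrow> real \<Rightarrow> real" where
  "tail_series lam \<theta> \<alpha> t = (\<Sum>q. (\<theta> * t) ^ q *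
     (\<Sum>r. (- lam * t powr \<alpha>) ^ r *
        ML3 \<alpha> (real r * \<alpha> + real q + 1) (real r) (\<theta> powr \<alpha> * t powr \<alpha>)))"

text \<open>Both remaining sums are geometric, with ratios
  \<open>- lam / (u powr \<alpha> - \<theta> powr \<alpha>)\<close> for \<open>r\<close> and
  \<open>\<theta> / u\<close> for \<open>q\<close>. The two conditions on \<open>w\<close> say that
  the corresponding series of bounds converge.\<close>

lemma laplace_dom_tail_series:
  fixes w \<alpha> \<theta> lam :: real
  assumes "\<alpha> > 0" "lam > 0" "\<theta> > 0" and w: "\<theta> < w" "lam < w powr \<alpha> - \<theta> powr \<alpha>"
  shows "\<exists>b. laplace_dom w (tail_series lam \<theta> \<alpha>) b
    (\<lambda>u. 1 / (u - \<theta>) * ((u powr \<alpha> - \<theta> powr \<alpha>) / (lam + (u powr \<alpha> - \<theta> powr \<alpha>))))"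
proof -
  define c where "c = \<theta> powr \<alpha>"
  define F where "F q r t = t ^ q * (t powr \<alpha>) ^ r * ML3 \<alpha> (real r * \<alpha> + real q + 1) (real r) (c * t powr \<alpha>)" for q r t
  have c: "c \<ge> 0" by (simp add: c_def)
  \<comment> \<open>Serves four sums: \<open>s = lam\<close> for the bounds and
    \<open>s = - lam\<close> for the transforms in \<open>r\<close>, then
    \<open>s = \<theta>\<close> for bounds and transforms in \<open>q\<close>.\<close>
  have geo: "(\<lambda>r. s ^ r * (1 / (v * V ^ r))) sums (1 / v * (V / (V - s)))" if "\<bar>s\<bar> < V" for s v V :: real
  proof -
    have "(\<lambda>r. 1 / v * (s / V) ^ r) sums (1 / v * (1 / (1 - s / V)))"
      using that by (intro sums_mult geometric_sums) auto
    moreover have "1 / (1 - s / V) = V / (V - s)"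
      using that by (auto simp: field_simps)
    ultimately show ?thesis
      by (simp add: power_divide)
  qed
  \<comment> \<open>The sum over \<open>r\<close> of the bounds at \<open>w\<close>. Taking absolute
    values turns \<open>- lam\<close> into \<open>lam\<close>, hence the minus sign in the
    denominator.\<close>
  define B where "B = (w powr \<alpha> - c) / (w powr \<alpha> - c - lam)"
  have mono: "w powr \<alpha> < u powr \<alpha>" if "u > w" for u
    using that assms by (intro powr_less_mono2) auto
  have inner: "laplace_dom w (\<lambda>t. t ^ q * (\<Sum>r. (- lam * t powr \<alpha>) ^ r * ML3 \<alpha> (real r * \<alpha> + real q + 1) (real r) (c * t powr \<alpha>)))
      (1 / w ^ q * B) (\<lambda>u. 1 / u ^ Suc q * ((u powr \<alpha> - c) / (lam + (u powr \<alpha> - c))))" for q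
  proof -
    have L: "laplace_dom w (\<lambda>t. (- lam) ^ r * F q r t) (lam ^ r * (1 / (w ^ q * (w powr \<alpha> - c) ^ r)))
       (\<lambda>u. (- lam) ^ r * (1 / (u ^ Suc q * (u powr \<alpha> - c) ^ r)))" for r
      using laplace_dom_cmult[OF laplace_dom_ML3[of w \<alpha> c q r], of "(- lam) ^ r"] assms c
      unfolding F_def c_def by (simp add: power_abs)
    have G: "(\<lambda>r. lam ^ r * (1 / (w ^ q * (w powr \<alpha> - c) ^ r))) sums (1 / w ^ q * B)"
      unfolding B_def using assms by (intro geo) (auto simp: c_def)
    note LS = laplace_dom_suminf[of w "\<lambda>r t. (- lam) ^ r * F q r t", OF L G]
    show ?thesis
    proof (rule laplace_dom_cong[OF LS(1)])
      fix t :: real assume t: "t \<ge> 0"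
      have eq: "(- lam) ^ r * F q r t = t ^ q * ((- lam * t powr \<alpha>) ^ r * ML3 \<alpha> (real r * \<alpha> + real q + 1) (real r) (c * t powr \<alpha>))" for r
        by (simp only: F_def power_mult_distrib mult_ac)
      show "(\<Sum>r. (- lam) ^ r * F q r t) = t ^ q * (\<Sum>r. (- lam * t powr \<alpha>) ^ r * ML3 \<alpha> (real r * \<alpha> + real q + 1) (real r) (c * t powr \<alpha>))"
        using LS(2)[OF t] unfolding eq by (rule suminf_cmult_real)
    next
      fix u assume u: "w < u"
      have "(\<lambda>r. (- lam) ^ r * (1 / (u ^ Suc q * (u powr \<alpha> - c) ^ r))) sums
         (1 / u ^ Suc q * ((u powr \<alpha> - c) / ((u powr \<alpha> - c) - (- lam))))"
        using mono[OF u] w assms by (intro geo) (auto simp: c_def)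
      then show "(\<Sum>r. (- lam) ^ r * (1 / (u ^ Suc q * (u powr \<alpha> - c) ^ r))) =
         1 / u ^ Suc q * ((u powr \<alpha> - c) / (lam + (u powr \<alpha> - c)))"
        by (simp add: sums_iff add_ac)
    qed simp
  qed
  have L: "laplace_dom w (\<lambda>t. \<theta> ^ q * (t ^ q * (\<Sum>r. (- lam * t powr \<alpha>) ^ r * ML3 \<alpha> (real r * \<alpha> + real q + 1) (real r) (c * t powr \<alpha>))))
      (\<theta> ^ q * (1 / w ^ q * B)) (\<lambda>u. \<theta> ^ q * (1 / u ^ Suc q * ((u powr \<alpha> - c) / (lam + (u powr \<alpha> - c)))))" for q
    using laplace_dom_cmult[OF inner[of q], of "\<theta> ^ q"] assms by simp
  have G: "(\<lambda>q. \<theta> ^ q * (1 / w ^ q * B)) sums (w / (w - \<theta>) * B)"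
    using sums_mult2[OF geo[of \<theta> w 1], of B] assms by (simp add: mult_ac)
  note LS = laplace_dom_suminf(1)[OF L G]
  have "laplace_dom w (tail_series lam \<theta> \<alpha>) (w / (w - \<theta>) * B)
    (\<lambda>u. 1 / (u - \<theta>) * ((u powr \<alpha> - c) / (lam + (u powr \<alpha> - c))))"
  proof (rule laplace_dom_cong[OF LS])
    fix u assume u: "w < u"
    then have "(\<lambda>q. \<theta> ^ q * (1 / (u * u ^ q))) sums (1 / u * (u / (u - \<theta>)))"
      using assms by (intro geo) auto
    from sums_mult2[OF this, of "(u powr \<alpha> - c) / (lam + (u powr \<alpha> - c))"]
    show "(\<Sum>q. \<theta> ^ q * (1 / u ^ Suc q * ((u powr \<alpha> - c) / (lam + (u powr \<alpha> - c))))) =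
      1 / (u - \<theta>) * ((u powr \<alpha> - c) / (lam + (u powr \<alpha> - c)))"
      using assms u by (simp add: sums_iff mult_ac)
  qed (auto simp: tail_series_def power_mult_distrib c_def mult_ac)
  then show ?thesis unfolding c_def by blast
qed

section \<open>Uniqueness of Laplace transforms and survival functions\<close>

text \<open>With \<open>x = exp (- t)\<close> the hypotheses say that all moments vanish, so by
  Weierstrass approximation every continuous function of \<open>exp (- t)\<close> integrates to zero
  against \<open>h\<close>. A bump to the right of a point where \<open>h\<close> is nonzero
  contradicts this; right continuity makes the conclusion pointwise.\<close>

lemma Lerch:
  fixes h :: "real \<Rightarrow> real"
  assumes h: "set_integrable lborel {0..} h"
    and 0: "\<And>n::nat. (LINT t:{0..}|lborel. exp (- real n * t) * h t) = 0"
    and c: "\<And>t. t \<ge> 0 \<Longrightarrow> continuous (at_right t) h"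
    and t: "t \<ge> 0"
  shows "h t = 0"
proof (rule ccontr)
  assume nz: "h t \<noteq> 0"
  have int: "set_integrable lborel {0..} (\<lambda>t. g (exp (- t)) * h t)" if g: "continuous_on {0..1} g" for g :: "real \<Rightarrow> real"
  proof -
    have "compact (g ` {0..1})"
      using g by (intro compact_continuous_image) auto
    then obtain B where "\<forall>y\<in>g ` {0..1}. norm y \<le> B"
      using compact_imp_bounded bounded_iff by blast
    then have B: "\<bar>g x\<bar> \<le> B" if "x \<in> {0..1}" for x
      using that by auto
    have "continuous_on {0..} (\<lambda>t::real. g (exp (- t)))"
      by (rule continuous_on_compose2[OF g]) (auto intro!: continuous_intros)
    then have "(\<lambda>t. indicator {0..} t *\<^sub>R g (exp (- t))) \<in> borel_measurable lborel"
      using borel_measurable_continuous_on_indicator[of "{0::real..}" "\<lambda>t. g (exp (- t))"] by simp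
    moreover have "(\<lambda>t. indicator {0..} t *\<^sub>R h t) \<in> borel_measurable lborel"
      using h unfolding set_integrable_def by simp
    ultimately have "(\<lambda>t. (indicator {0..} t *\<^sub>R g (exp (- t))) * (indicator {0..} t *\<^sub>R h t)) \<in> borel_measurable lborel"
      by measurable
    also have "(\<lambda>t. (indicator {0..} t *\<^sub>R g (exp (- t))) * (indicator {0..} t *\<^sub>R h t)) = (\<lambda>t. indicat_real {0..} t *\<^sub>R (g (exp (- t)) * h t))"
      by (auto simp: indicator_def)
    finally have meas: "set_borel_measurable lborel {0..} (\<lambda>t. g (exp (- t)) * h t)"
      unfolding set_borel_measurable_def .
    have "set_integrable lborel {0..} (\<lambda>t. B * h t)"
      using h by simp
    then show ?thesis
    proof (rule set_integrable_bound[OF _ meas], intro AE_I2 impI)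
      fix t :: real assume "t \<in> {0..}"
      then have "\<bar>g (exp (- t))\<bar> * \<bar>h t\<bar> \<le> \<bar>B\<bar> * \<bar>h t\<bar>"
        using B[of "exp (- t)"] by (intro mult_right_mono) auto
      then show "norm (g (exp (- t)) * h t) \<le> norm (B * h t)"
        by (simp add: abs_mult)
    qed
  qed
  have poly: "(LINT t:{0..}|lborel. p (exp (- t)) * h t) = 0" if "real_polynomial_function p" for p
  proof -
    obtain a n where p: "p = (\<lambda>x. \<Sum>i\<le>n. a i * x ^ i)"
      using \<open>real_polynomial_function p\<close> unfolding real_polynomial_function_iff_sum by auto
    have "(LINT t:{0..}|lborel. p (exp (- t)) * h t) = (LINT t:{0..}|lborel. (\<Sum>i\<le>n. a i * (exp (- t) ^ i * h t)))"
      by (simp add: p sum_distrib_left sum_distrib_right mult_ac)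
    also have "\<dots> = (\<Sum>i\<le>n. (LINT t:{0..}|lborel. a i * (exp (- t) ^ i * h t)))"
    proof -
      have "set_integrable lborel {0..} (\<lambda>t. a i * (exp (- t) ^ i * h t))" for i
        by (intro set_integrable_mult_right int[of "\<lambda>x. x ^ i"] continuous_intros)
      then show ?thesis
        unfolding set_lebesgue_integral_def set_integrable_def scaleR_sum_right
        by (rule Bochner_Integration.integral_sum)
    qed
    also have "\<dots> = 0"
      using 0 by (simp add: exp_of_nat_mult[symmetric])
    finally show ?thesis .
  qed
  have cont: "(LINT t:{0..}|lborel. g (exp (- t)) * h t) = 0" if g: "continuous_on {0..1} g" for g
  proof -
    define H where "H = (LINT t:{0..}|lborel. \<bar>h t\<bar>)"
    have H: "H \<ge> 0" unfolding H_def set_lebesgue_integral_def by (intro Bochner_Integration.integral_nonneg) auto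
    have bd: "\<bar>LINT t:{0..}|lborel. g (exp (- t)) * h t\<bar> \<le> e * H" if e: "e > 0" for e
    proof -
      obtain p where p: "real_polynomial_function p" "\<And>x. x \<in> {0..1} \<Longrightarrow> \<bar>g x - p x\<bar> < e"
        using Stone_Weierstrass_real_polynomial_function[OF _ g e] by auto
      have cp: "continuous_on {0..1} p"
        using p(1) unfolding real_polynomial_function_iff_sum by (auto intro!: continuous_intros)
      have "(LINT t:{0..}|lborel. g (exp (- t)) * h t) = (LINT t:{0..}|lborel. g (exp (- t)) * h t) - (LINT t:{0..}|lborel. p (exp (- t)) * h t)"
        using poly[OF p(1)] by simp
      also have "\<dots> = (LINT t:{0..}|lborel. g (exp (- t)) * h t - p (exp (- t)) * h t)"
        by (intro set_integral_diff(2)[symmetric] int g cp)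
      also have "\<bar>\<dots>\<bar> \<le> (LINT t:{0..}|lborel. \<bar>g (exp (- t)) * h t - p (exp (- t)) * h t\<bar>)"
        using set_integral_norm_bound[of lborel "{0..}" "\<lambda>t. g (exp (- t)) * h t - p (exp (- t)) * h t"] int[OF g] int[OF cp] by auto
      also have "\<dots> \<le> (LINT t:{0..}|lborel. e * \<bar>h t\<bar>)"
      proof (intro set_integral_mono)
        fix t :: real assume "t \<in> {0..}"
        then show "\<bar>g (exp (- t)) * h t - p (exp (- t)) * h t\<bar> \<le> e * \<bar>h t\<bar>"
          unfolding left_diff_distrib[symmetric] abs_mult using p(2)[of "exp (- t)"]
          by (intro mult_right_mono) auto
      qed (use int[OF g] int[OF cp] h in \<open>auto intro!: set_integrable_abs\<close>)
      also have "\<dots> = e * H" by (simp add: H_def)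
      finally show ?thesis .
    qed
    have "\<bar>LINT t:{0..}|lborel. g (exp (- t)) * h t\<bar> \<le> e" if "e > 0" for e
    proof -
      \<comment> \<open>Dividing by \<open>H + 1\<close> instead of \<open>H\<close> covers
        \<open>H = 0\<close>.\<close>
      have "\<bar>LINT t:{0..}|lborel. g (exp (- t)) * h t\<bar> \<le> e / (H + 1) * H"
        using that H by (intro bd) auto
      also have "\<dots> \<le> e" using that H by (simp add: field_simps)
      finally show ?thesis .
    qed
    then have "\<bar>LINT t:{0..}|lborel. g (exp (- t)) * h t\<bar> \<le> 0"
      by (rule field_le_epsilon) simp
    then show ?thesis by simp
  qed
  have "(h \<longlongrightarrow> h t) (at_right t)"
    using c[OF t] by (simp add: continuous_within)
  \<comment> \<open>Multiplication by \<open>h t\<close> treats both signs at once.\<close>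
  then have "((\<lambda>s. h t * h s) \<longlongrightarrow> h t * h t) (at_right t)"
    by (intro tendsto_intros)
  then have "\<forall>\<^sub>F s in at_right t. 0 < h t * h s"
    by (rule order_tendstoD(1)) (use nz in \<open>auto simp: zero_less_mult_iff\<close>)
  then obtain d where d: "d > t" "\<And>s. t < s \<Longrightarrow> s < d \<Longrightarrow> 0 < h t * h s"
    unfolding eventually_at_right_field by auto
  \<comment> \<open>A bump that, at \<open>x = exp (- s)\<close>, is nonzero exactly for
    \<open>t < s\<close> and \<open>s < d\<close>, carrying the sign of \<open>h t\<close>.\<close>
  define g where "g x = h t * max 0 ((exp (- t) - x) * (x - exp (- d)))" for x :: real
  have gc: "continuous_on {0..1} g"
    unfolding g_def by (intro continuous_intros)
  define f where "f s = indicator {0..} s *\<^sub>R (g (exp (- s)) * h s)" for s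
  have f0: "integral\<^sup>L lborel f = 0" "integrable lborel f"
    using cont[OF gc] int[OF gc] unfolding f_def set_lebesgue_integral_def set_integrable_def by auto
  have mid: "(exp (- t) - exp (- s)) * (exp (- s) - exp (- d)) > 0 \<longleftrightarrow> t < s \<and> s < d" for s :: real
    using d(1) by (auto simp: zero_less_mult_iff)
  have fs: "f s = ((exp (- t) - exp (- s)) * (exp (- s) - exp (- d))) * (h t * h s)" "h t * h s > 0" if "t < s" "s < d" for s
    using d(2)[OF that] mid[of s] that t by (simp_all add: f_def g_def)
  have fp: "f s > 0" if "t < s" "s < d" for s
    using fs[OF that] mid[of s] that by (metis mult_pos_pos)
  have fn: "f s \<ge> 0" for s
  proof (cases "t < s \<and> s < d")
    case True
    then show ?thesis using fp by (auto intro: less_imp_le)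
  next
    case False
    then have "\<not> (exp (- t) - exp (- s)) * (exp (- s) - exp (- d)) > 0"
      using mid by blast
    then have "g (exp (- s)) = 0"
      unfolding g_def by (simp only: max_def not_less) simp
    then show ?thesis by (simp add: f_def)
  qed
  have "AE s in lborel. f s = 0"
    using integral_nonneg_eq_0_iff_AE[OF f0(2)] f0(1) fn by auto
  then have "AE s in lborel. s \<notin> {t<..<d}"
    by eventually_elim (use fp in force)
  then have "emeasure lborel {t<..<d} = 0"
    by (subst (asm) AE_iff_measurable[OF _ refl]) (auto simp: greaterThanLessThan_def Int_def)
  then show False using d(1) by simp
qed

text \<open>Tonelli for \<open>exp (- s * t)\<close> on the region \<open>0 \<le> t < X\<close>:
  integrating over \<open>t\<close> first gives \<open>(1 - exp (- s * X)) / s\<close>.\<close>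

lemma (in prob_space) laplace_survival:
  fixes X :: "'a \<Rightarrow> real"
  assumes [measurable]: "X \<in> borel_measurable M" and X: "AE \<omega> in M. X \<omega> \<ge> 0" and s: "s > 0"
  shows "set_integrable lborel {0..} (\<lambda>t. exp (- s * t) * \<P>(\<omega> in M. X \<omega> > t))"
    and "(LINT t:{0..}|lborel. exp (- s * t) * \<P>(\<omega> in M. X \<omega> > t)) = (1 - expectation (\<lambda>\<omega>. exp (- s * X \<omega>))) / s"
proof -
  interpret pair_sigma_finite M lborel ..
  have i: "integrable M (\<lambda>\<omega>. exp (- s * X \<omega>))"
    using X s by (intro integrable_const_bound[where B = 1]) (auto elim!: eventually_mono)
  have inner: "(\<integral>\<^sup>+ t. ennreal (exp (- s * t)) * indicator {0..<x} t \<partial>lborel) = ennreal ((1 - exp (- s * x)) / s)"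
    if "x \<ge> 0" for x
  proof -
    have "AE t in lborel. t \<noteq> x" by (rule AE_lborel_singleton)
    then have "(\<integral>\<^sup>+ t. ennreal (exp (- s * t)) * indicator {0..<x} t \<partial>lborel) =
      (\<integral>\<^sup>+ t. ennreal (exp (- s * t)) * indicator {0..x} t \<partial>lborel)"
      by (intro nn_integral_cong_AE) (auto elim!: eventually_mono simp: indicator_def)
    also have "\<dots> = ennreal ((- exp (- s * x) / s) - (- exp (- s * 0) / s))"
      using s that by (intro nn_integral_FTC_Icc) (auto intro!: derivative_eq_intros)
    finally show ?thesis using s by (simp add: diff_divide_distrib)
  qed
  have "(\<integral>\<^sup>+ t. ennreal (indicator {0..} t *\<^sub>R (exp (- s * t) * \<P>(\<omega> in M. X \<omega> > t))) \<partial>lborel)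
     = (\<integral>\<^sup>+ t. \<integral>\<^sup>+ \<omega>. ennreal (exp (- s * t)) * indicator {0..<X \<omega>} t \<partial>M \<partial>lborel)"
  proof (rule nn_integral_cong)
    fix t :: real
    have "(\<integral>\<^sup>+ \<omega>. ennreal (exp (- s * t)) * indicator {0..<X \<omega>} t \<partial>M)
      = (\<integral>\<^sup>+ \<omega>. ennreal (indicator {0..} t * exp (- s * t)) * indicator {\<omega> \<in> space M. X \<omega> > t} \<omega> \<partial>M)"
      by (intro nn_integral_cong) (auto simp: indicator_def)
    also have "\<dots> = ennreal (indicator {0..} t * exp (- s * t)) * emeasure M {\<omega> \<in> space M. X \<omega> > t}"
      by (intro nn_integral_cmult_indicator) measurable
    also have "\<dots> = ennreal (indicator {0..} t *\<^sub>R (exp (- s * t) * \<P>(\<omega> in M. X \<omega> > t)))"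
      by (auto simp: emeasure_eq_measure indicator_def ennreal_mult)
    finally show "ennreal (indicator {0..} t *\<^sub>R (exp (- s * t) * \<P>(\<omega> in M. X \<omega> > t))) =
      (\<integral>\<^sup>+ \<omega>. ennreal (exp (- s * t)) * indicator {0..<X \<omega>} t \<partial>M)" by simp
  qed
  also have "\<dots> = (\<integral>\<^sup>+ \<omega>. \<integral>\<^sup>+ t. ennreal (exp (- s * t)) * indicator {0..<X \<omega>} t \<partial>lborel \<partial>M)"
  proof (rule Fubini')
    have "(\<lambda>p. ennreal (exp (- s * snd p)) * indicator {p. 0 \<le> snd p \<and> snd p < X (fst p)} p) \<in> borel_measurable (M \<Otimes>\<^sub>M lborel)"
      by measurable
    then show "(\<lambda>(\<omega>, t). ennreal (exp (- s * t)) * indicator {0..<X \<omega>} t) \<in> borel_measurable (M \<Otimes>\<^sub>M lborel)"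
      by (simp add: case_prod_beta indicator_def)
  qed
  also have "\<dots> = (\<integral>\<^sup>+ \<omega>. ennreal ((1 - exp (- s * X \<omega>)) / s) \<partial>M)"
  proof (rule nn_integral_cong_AE)
    show "AE \<omega> in M. (\<integral>\<^sup>+ t. ennreal (exp (- s * t)) * indicator {0..<X \<omega>} t \<partial>lborel) = ennreal ((1 - exp (- s * X \<omega>)) / s)"
      using X by eventually_elim (rule inner)
  qed
  also have "\<dots> = ennreal (expectation (\<lambda>\<omega>. (1 - exp (- s * X \<omega>)) / s))"
    using X s i by (intro nn_integral_eq_integral) (auto elim!: eventually_mono)
  also have "expectation (\<lambda>\<omega>. (1 - exp (- s * X \<omega>)) / s) = (1 - expectation (\<lambda>\<omega>. exp (- s * X \<omega>))) / s"
    using i by (simp add: prob_space)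
  finally have eq: "(\<integral>\<^sup>+ t. ennreal (indicator {0..} t *\<^sub>R (exp (- s * t) * \<P>(\<omega> in M. X \<omega> > t))) \<partial>lborel)
    = ennreal ((1 - expectation (\<lambda>\<omega>. exp (- s * X \<omega>))) / s)" .
  have "expectation (\<lambda>\<omega>. exp (- s * X \<omega>)) \<le> 1"
    using X s i by (intro integral_le_const) (auto elim!: eventually_mono)
  moreover have "(\<lambda>t. \<P>(\<omega> in M. X \<omega> > t)) \<in> borel_measurable lborel"
    by measurable
  ultimately have "has_bochner_integral lborel (\<lambda>t. indicator {0..} t *\<^sub>R (exp (- s * t) * \<P>(\<omega> in M. X \<omega> > t)))
    ((1 - expectation (\<lambda>\<omega>. exp (- s * X \<omega>))) / s)"
    using s eq by (intro has_bochner_integral_nn_integral) (auto intro!: AE_I2)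
  then show "set_integrable lborel {0..} (\<lambda>t. exp (- s * t) * \<P>(\<omega> in M. X \<omega> > t))"
    and "(LINT t:{0..}|lborel. exp (- s * t) * \<P>(\<omega> in M. X \<omega> > t)) = (1 - expectation (\<lambda>\<omega>. exp (- s * X \<omega>))) / s"
    unfolding set_integrable_def set_lebesgue_integral_def by (auto simp: has_bochner_integral_iff)
qed

text \<open>The strict inequality makes this one minus the distribution function. It supplies the
  regularity demanded by \<open>Lerch\<close>.\<close>

lemma (in prob_space) survival_right_continuous:
  fixes X :: "'a \<Rightarrow> real"
  assumes [measurable]: "X \<in> borel_measurable M"
  shows "continuous (at_right t) (\<lambda>t. \<P>(\<omega> in M. X \<omega> > t))"
proof -
  interpret D: real_distribution "distr M borel X"
    by (rule real_distribution_distr) measurable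
  have "\<P>(\<omega> in M. X \<omega> > t) = 1 - cdf (distr M borel X) t" for t
  proof -
    have "\<P>(\<omega> in M. X \<omega> > t) = \<P>(\<omega> in M. \<not> X \<omega> \<le> t)" by (simp add: not_le)
    also have "\<dots> = 1 - \<P>(\<omega> in M. X \<omega> \<le> t)" by (rule prob_neg) measurable
    also have "\<P>(\<omega> in M. X \<omega> \<le> t) = cdf (distr M borel X) t"
      by (simp add: cdf_def measure_distr vimage_def Int_def conj_commute)
    finally show ?thesis .
  qed
  then show ?thesis
    by (auto intro!: continuous_intros D.cdf_is_right_cont)
qed

section \<open>Left limits and first passage times\<close>

text \<open>For nondecreasing \<open>f\<close> and \<open>x > 0\<close> this is the left limit at
  \<open>x\<close>. The countable supremum keeps it measurable, and the clamp keeps arguments where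
  \<open>D\<close> is controlled.\<close>

definition left_lim :: "(real \<Rightarrow> real) \<Rightarrow> real \<Rightarrow> real" where
  "left_lim f x = (SUP m::nat. f (max 0 (x - 1 / real (Suc m))))"

lemma max_diff_inverse_le: "max 0 (x - 1 / real (Suc m)) \<le> max 0 x"
  by (intro max.mono) auto

lemma left_lim_bdd:
  assumes "mono_on {0..} f"
  shows "bdd_above (range (\<lambda>m::nat. f (max 0 (x - 1 / real (Suc m)))))"
  using assms by (intro bdd_aboveI2[where M = "f (max 0 x)"] mono_onD[OF assms] max_diff_inverse_le) auto

lemma left_lim_upper:
  assumes "mono_on {0..} f"
  shows "f (max 0 (x - 1 / real (Suc m))) \<le> left_lim f x"
  unfolding left_lim_def by (rule cSUP_upper[OF _ left_lim_bdd[OF assms]]) simp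

lemma left_lim_le:
  assumes "mono_on {0..} f"
  shows "left_lim f x \<le> f (max 0 x)"
  unfolding left_lim_def by (intro cSUP_least mono_onD[OF assms] max_diff_inverse_le) auto

text \<open>\<^term>\<open>Inf {} :: real\<close> is an unspecified number; it enters when \<open>f\<close> is bounded.\<close>

lemma Inf_inverse_level:
  fixes f :: "real \<Rightarrow> real"
  assumes mono: "mono_on {0..} f" and f0: "f 0 = 0"
  shows "Inf {t. 0 \<le> t \<and> x \<le> Inf {y. 0 < y \<and> t < f y}} =
    (if x > Inf {} \<and> (\<forall>n::nat. f (real n) \<le> left_lim f x) then Inf {} else left_lim f x)"
proof -
  define L where "L = left_lim f x"
  have L0: "L \<ge> 0"
    using left_lim_upper[OF mono, of x 0] mono_onD[OF mono, of 0 "max 0 (x - 1 / real (Suc 0))"] f0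
    by (simp add: L_def)
  \<comment> \<open>The Galois correspondence between a monotone path and its inverse; the left
    limit appears because the comparison with \<open>x\<close> is not strict.\<close>
  have nonempty: "x \<le> Inf {y. 0 < y \<and> t < f y} \<longleftrightarrow> L \<le> t" if t: "t \<ge> 0" and ne: "{y. 0 < y \<and> t < f y} \<noteq> {}" for t
  proof
    assume x: "x \<le> Inf {y. 0 < y \<and> t < f y}"
    have "f (max 0 (x - 1 / real (Suc m))) \<le> t" for m
    proof (rule ccontr)
      let ?z = "max 0 (x - 1 / real (Suc m))"
      assume "\<not> f ?z \<le> t"
      then have z: "t < f ?z" by simp
      have z0: "0 < ?z"
        using z f0 t by (cases "?z = 0") auto
      have "Inf {y. 0 < y \<and> t < f y} \<le> ?z"
        using z z0 by (intro cInf_lower) (auto intro!: bdd_belowI[of _ 0])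
      moreover have "?z < x"
      proof -
        have "x - 1 / real (Suc m) < x" by simp
        with z0 show ?thesis by linarith
      qed
      ultimately show False using x by linarith
    qed
    then show "L \<le> t"
      unfolding L_def left_lim_def by (intro cSUP_least) auto
  next
    assume L: "L \<le> t"
    show "x \<le> Inf {y. 0 < y \<and> t < f y}"
    proof (rule cInf_greatest[OF ne])
      fix y assume y: "y \<in> {y. 0 < y \<and> t < f y}"
      show "x \<le> y"
      proof (rule ccontr)
        assume "\<not> x \<le> y"
        then have "0 < x - y" by simp
        then obtain m where m: "inverse (real (Suc m)) < x - y"
          using reals_Archimedean by blast
        have "f y \<le> f (max 0 (x - 1 / real (Suc m)))"
          using m y by (intro mono_onD[OF mono]) (auto simp: inverse_eq_divide)
        also have "\<dots> \<le> L"
          unfolding L_def by (rule left_lim_upper[OF mono])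
        finally show False using L y by auto
      qed
    qed
  qed
  \<comment> \<open>An empty level set means that the path never exceeds \<open>t\<close>.\<close>
  have empty: "L \<le> t" if t: "{y. 0 < y \<and> t < f y} = {}" "t \<ge> 0" for t
    unfolding L_def left_lim_def
  proof (intro cSUP_least)
    fix m
    show "f (max 0 (x - 1 / real (Suc m))) \<le> t"
    proof (cases "x - 1 / real (Suc m) > 0")
      case True
      then have "\<not> t < f (x - 1 / real (Suc m))"
        using t by blast
      with True show ?thesis by simp
    qed (use t f0 in auto)
  qed simp
  show ?thesis
  proof (cases "x > Inf {}")
    case False
    \<comment> \<open>If \<open>x \<le> Inf {}\<close>, levels never exceeded by the path also
      satisfy the condition; by \<open>empty\<close> they lie above \<open>L\<close> anyway.\<close>
    have "{t. 0 \<le> t \<and> x \<le> Inf {y. 0 < y \<and> t < f y}} = {L..}"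
    proof (intro set_eqI)
      fix t
      show "t \<in> {t. 0 \<le> t \<and> x \<le> Inf {y. 0 < y \<and> t < f y}} \<longleftrightarrow> t \<in> {L..}"
      proof (cases "{y. 0 < y \<and> t < f y} = {}")
        case e: True
        show ?thesis unfolding mem_Collect_eq e using empty[OF e] False L0 by auto
      next
        case ne: False
        then show ?thesis using nonempty[OF _ ne] L0 by auto
      qed
    qed
    with False show ?thesis by (simp add: L_def)
  next
    case True
    \<comment> \<open>Now levels never exceeded by the path are excluded. Nothing remains if the
      path stays at or below \<open>L\<close>; otherwise \<open>L\<close> itself is the
      minimum.\<close>
    then have eq: "t \<in> {t. 0 \<le> t \<and> x \<le> Inf {y. 0 < y \<and> t < f y}} \<longleftrightarrow> L \<le> t \<and> (\<exists>y>0. t < f y)" for t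
    proof (cases "{y. 0 < y \<and> t < f y} = {}")
      case e: True
      then have "\<not> (\<exists>y>0. t < f y)" by blast
      then show ?thesis unfolding mem_Collect_eq e using True by auto
    next
      case ne: False
      then show ?thesis using nonempty[OF _ ne] L0 by auto
    qed
    show ?thesis
    proof (cases "\<forall>n::nat. f (real n) \<le> L")
      case all: True
      have le: "f y \<le> L" if "y > 0" for y
      proof -
        have "f y \<le> f (real (nat \<lceil>y\<rceil>))"
          using that by (intro mono_onD[OF mono]) (auto simp: of_nat_ceiling)
        with all show ?thesis by (meson order_trans)
      qed
      have "{t. 0 \<le> t \<and> x \<le> Inf {y. 0 < y \<and> t < f y}} = {}"
      proof (rule equals0I)
        fix t assume "t \<in> {t. 0 \<le> t \<and> x \<le> Inf {y. 0 < y \<and> t < f y}}"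
        then obtain y where "L \<le> t" "y > 0" "t < f y" unfolding eq by blast
        with le[of y] show False by linarith
      qed
      then show ?thesis unfolding \<open>{t. 0 \<le> t \<and> x \<le> Inf {y. 0 < y \<and> t < f y}} = {}\<close>
        using all True by (simp add: L_def)
    next
      case False
      then obtain n :: nat where n: "L < f (real n)" by (auto simp: not_le)
      then have "real n \<noteq> 0" using L0 f0 by (cases n) auto
      with n have "\<exists>y>0. L < f y" by (intro exI[of _ "real n"]) auto
      then have "Inf {t. 0 \<le> t \<and> x \<le> Inf {y. 0 < y \<and> t < f y}} = L"
        using eq by (intro cInf_eq_minimum) blast+
      with False show ?thesis by (auto simp: L_def)
    qed
  qed
qed

section \<open>Arrivals at subordinated times\<close>

locale subordinated_arrivals = prob_space M for M :: "'a measure" +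
  fixes lam \<theta> \<alpha> :: real and E :: "nat \<Rightarrow> 'a \<Rightarrow> real" and D :: "real \<Rightarrow> 'a \<Rightarrow> real"
  assumes lam: "lam > 0" and \<theta>: "\<theta> > 0" and \<alpha>: "0 < \<alpha>"
    and E_indep: "indep_vars (\<lambda>_. borel) E UNIV"
    and E_distributed: "\<And>n. distributed M lborel (E n) (exponential_density lam)"
    and subordinator: "tempered_stable_subordinator M \<theta> \<alpha> D"
    and indep: "indep_set
           (sets (vimage_algebra (space M) (\<lambda>\<omega>. restrict (\<lambda>x. D x \<omega>) {0::real..})
                   (PiM {0::real..} (\<lambda>_. borel))))
           (sets (vimage_algebra (space M) (\<lambda>\<omega> n. E n \<omega>) (PiM UNIV (\<lambda>_. borel))))"
begin

definition F where
  "F = vimage_algebra (space M) (\<lambda>\<omega>. restrict (\<lambda>x. D x \<omega>) {0::real..}) (PiM {0::real..} (\<lambda>_. borel :: real measure))"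

definition G :: "(nat \<Rightarrow> real) measure" where "G = PiM UNIV (\<lambda>_. borel)"

definition \<psi> where "\<psi> s = (s + \<theta>) powr \<alpha> - \<theta> powr \<alpha>"

text \<open>The properties of \<open>D\<close> concern nonnegative times, whereas the epochs are
  nonnegative only almost surely; the clamp makes \<open>Z\<close> meaningful at every real
  time.\<close>

definition Z where "Z x \<omega> = D (max 0 x) \<omega>"

lemma D_measurable: "x \<ge> 0 \<Longrightarrow> D x \<in> borel_measurable M"
  and D_zero: "\<omega> \<in> space M \<Longrightarrow> D 0 \<omega> = 0"
  and D_mono: "\<omega> \<in> space M \<Longrightarrow> mono_on {0..} (\<lambda>x. D x \<omega>)"
  and D_right_cont: "\<omega> \<in> space M \<Longrightarrow> x \<ge> 0 \<Longrightarrow> continuous (at_right x) (\<lambda>y. D y \<omega>)"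
  and D_indep: "\<And>n s. 0 \<le> s 0 \<Longrightarrow> (\<And>i::nat. s i \<le> s (Suc i)) \<Longrightarrow>
         indep_vars (\<lambda>_. borel) (\<lambda>i \<omega>. D (s (Suc i)) \<omega> - D (s i) \<omega>) {..<n::nat}"
  and D_stationary: "0 \<le> s \<Longrightarrow> 0 \<le> h \<Longrightarrow> distr M borel (\<lambda>\<omega>. D (s + h) \<omega> - D s \<omega>) = distr M borel (D h)"
  and D_laplace: "0 \<le> s \<Longrightarrow> 0 \<le> t \<Longrightarrow> expectation (\<lambda>\<omega>. exp (- s * D t \<omega>)) = exp (- t * \<psi> s)"
  using subordinator unfolding tempered_stable_subordinator_def \<psi>_def by blast+

lemma D_nonneg: "\<omega> \<in> space M \<Longrightarrow> x \<ge> 0 \<Longrightarrow> D x \<omega> \<ge> 0"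
  using mono_onD[OF D_mono, of \<omega> 0 x] D_zero[of \<omega>] by auto

lemma \<psi>_pos: "s > 0 \<Longrightarrow> \<psi> s > 0"
  unfolding \<psi>_def using \<theta> \<alpha> powr_less_mono2[of \<alpha> \<theta> "s + \<theta>"] by simp

lemma E_measurable [measurable]: "E n \<in> borel_measurable M"
  using distributed_measurable[OF E_distributed[of n]] by simp

lemma E_G_measurable [measurable]: "(\<lambda>\<omega> n. E n \<omega>) \<in> measurable M G"
  unfolding G_def by (rule measurable_PiM_single') auto

lemma coord_measurable [measurable]: "(\<lambda>e. e n) \<in> borel_measurable G"
  unfolding G_def by (rule measurable_component_singleton) simp

section \<open>Joint measurability in path and time\<close>

lemma space_F: "space F = space M"
  by (simp add: F_def)

lemma id_F_measurable [measurable]: "(\<lambda>\<omega>. \<omega>) \<in> measurable M F"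
  unfolding F_def by (intro measurable_vimage_algebra2 measurable_restrict) (auto intro: D_measurable)

lemma D_F_measurable:
  assumes "x \<ge> 0" shows "D x \<in> borel_measurable F"
proof -
  have "(\<lambda>\<omega>. restrict (\<lambda>x. D x \<omega>) {0..} x) \<in> borel_measurable F"
    unfolding F_def
    by (rule measurable_compose[OF measurable_vimage_algebra1 measurable_component_singleton])
       (use assms in \<open>auto simp: space_PiM split: if_splits\<close>)
  then show ?thesis using assms by simp
qed

text \<open>Right continuity: \<open>Z\<close> at a random time is the limit of its values at random
  times taking countably many values, where measurability at fixed times suffices.\<close>

lemma Z_measurable [measurable (raw)]:
  assumes [measurable]: "x \<in> borel_measurable N" "g \<in> measurable N F"
  shows "(\<lambda>z. Z (x z) (g z)) \<in> borel_measurable N"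
proof (rule borel_measurable_LIMSEQ_metric)
  \<comment> \<open>The next grid point of mesh \<open>1 / Suc m\<close> strictly to the right of
    \<open>y\<close>. The \<open>+ 1\<close> gives strictness, needed for convergence within
    \<open>at_right\<close>.\<close>
  define u where "u m y = real (nat \<lfloor>real (Suc m) * y\<rfloor> + 1) / real (Suc m)" for m and y :: real
  show "(\<lambda>z. D (u m (max 0 (x z))) (g z)) \<in> borel_measurable N" for m
    unfolding u_def
  proof (rule measurable_compose_countable[where f = "\<lambda>i z. D (real (i + 1) / real (Suc m)) (g z)"])
    show "(\<lambda>z. D (real (i + 1) / real (Suc m)) (g z)) \<in> borel_measurable N" for i
      by (rule measurable_compose[OF assms(2) D_F_measurable]) simp
  qed measurable
  fix z assume z: "z \<in> space N"
  define y where "y = max 0 (x z)"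
  have y: "y \<ge> 0" by (simp add: y_def)
  have g: "g z \<in> space M"
    using measurable_space[OF assms(2) z] by (simp add: space_F)
  have u: "y < u m y \<and> u m y \<le> y + 1 / real (Suc m)" for m
  proof -
    have "real (nat \<lfloor>real (Suc m) * y\<rfloor>) = of_int \<lfloor>real (Suc m) * y\<rfloor>"
      using y by simp
    then have "real (Suc m) * y < real (nat \<lfloor>real (Suc m) * y\<rfloor> + 1)" "real (nat \<lfloor>real (Suc m) * y\<rfloor> + 1) \<le> real (Suc m) * y + 1"
      by linarith+
    then show ?thesis
      unfolding u_def by (simp add: pos_less_divide_eq pos_divide_le_eq algebra_simps del: of_nat_Suc)
  qed
  have "(\<lambda>m. u m y) \<longlonglongrightarrow> y"
  proof (rule tendsto_sandwich[of "\<lambda>m. y" _ _ "\<lambda>m. y + 1 / real (Suc m)"])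
    show "(\<lambda>m. y + 1 / real (Suc m)) \<longlonglongrightarrow> y"
      using tendsto_add[OF tendsto_const[of y] LIMSEQ_inverse_real_of_nat] by (simp add: inverse_eq_divide)
  qed (use less_imp_le[OF conjunct1[OF u]] conjunct2[OF u] in \<open>auto intro!: always_eventually simp del: of_nat_Suc\<close>)
  then have "filterlim (\<lambda>m. u m y) (at_right y) sequentially"
    using u by (auto simp: filterlim_at intro!: always_eventually less_imp_neq[symmetric])
  moreover have "((\<lambda>v. D v (g z)) \<longlongrightarrow> D y (g z)) (at_right y)"
    using D_right_cont[OF g y] by (simp add: continuous_within)
  ultimately show "(\<lambda>m. D (u m (max 0 (x z))) (g z)) \<longlonglongrightarrow> Z (x z) (g z)"
    unfolding Z_def y_def[symmetric] by (rule filterlim_compose[rotated])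
qed

lemma left_lim_measurable [measurable (raw)]:
  assumes [measurable]: "x \<in> borel_measurable N" "g \<in> measurable N F"
  shows "(\<lambda>z. left_lim (\<lambda>y. D y (g z)) (x z)) \<in> borel_measurable N"
  unfolding left_lim_def
proof (rule borel_measurable_cSUP)
  show "(\<lambda>z. D (max 0 (x z - 1 / real (Suc m))) (g z)) \<in> borel_measurable N" for m
    unfolding Z_def[symmetric] by measurable
  show "bdd_above ((\<lambda>m. D (max 0 (x z - 1 / real (Suc m))) (g z)) ` UNIV)" if "z \<in> space N" for z
    using measurable_space[OF assms(2) that] by (intro left_lim_bdd D_mono) (simp add: space_F)
qed simp

text \<open>Independence of \<open>D\<close> and \<open>E\<close> allows freezing the arrival process. Joint measurability in
  the path and in time is not available on the product \<open>\<sigma>\<close>-algebra of paths, hence the use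
  of \<open>F\<close> on the sample space.\<close>

lemma nn_integral_split:
  assumes [measurable]: "h \<in> borel_measurable (F \<Otimes>\<^sub>M G)"
  shows "(\<integral>\<^sup>+\<omega>. h (\<omega>, \<lambda>n. E n \<omega>) \<partial>M) = (\<integral>\<^sup>+\<omega>'. \<integral>\<^sup>+\<omega>. h (\<omega>, \<lambda>n. E n \<omega>') \<partial>M \<partial>M)"
proof -
  interpret P1: prob_space "distr M F (\<lambda>\<omega>. \<omega>)" by (rule prob_space_distr) measurable
  interpret P2: prob_space "distr M G (\<lambda>\<omega> n. E n \<omega>)" by (rule prob_space_distr) measurable
  interpret P: pair_sigma_finite "distr M F (\<lambda>\<omega>. \<omega>)" "distr M G (\<lambda>\<omega> n. E n \<omega>)" ..
  \<comment> \<open>The identity map into \<open>F\<close> plays the role of the random path, so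
    independence of the two generated \<sigma>-algebras becomes a product law.\<close>
  have eq: "distr M F (\<lambda>\<omega>. \<omega>) \<Otimes>\<^sub>M distr M G (\<lambda>\<omega> n. E n \<omega>) = distr M (F \<Otimes>\<^sub>M G) (\<lambda>\<omega>. (\<omega>, \<lambda>n. E n \<omega>))"
  proof (rule pair_measure_eqI)
    fix A B assume "A \<in> sets (distr M F (\<lambda>\<omega>. \<omega>))" "B \<in> sets (distr M G (\<lambda>\<omega> n. E n \<omega>))"
    then have A [measurable]: "A \<in> sets F" and B [measurable]: "B \<in> sets G" by auto
    have "A \<subseteq> space M" using sets.sets_into_space[OF A] by (simp add: space_F)
    then have A': "A \<inter> space M = A" by auto
    define B' where "B' = (\<lambda>\<omega> n. E n \<omega>) -` B \<inter> space M"
    have "B' \<in> sets (vimage_algebra (space M) (\<lambda>\<omega> n. E n \<omega>) G)"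
      unfolding B'_def by (rule in_vimage_algebra[OF B])
    then have "prob (A \<inter> B') = prob A * prob B'"
      using indep A unfolding F_def G_def by (intro indep_setD)
    moreover have "(\<lambda>\<omega>. (\<omega>, \<lambda>n. E n \<omega>)) -` (A \<times> B) \<inter> space M = A \<inter> B'"
      using \<open>A \<subseteq> space M\<close> by (auto simp: B'_def)
    ultimately show "emeasure (distr M F (\<lambda>\<omega>. \<omega>)) A * emeasure (distr M G (\<lambda>\<omega> n. E n \<omega>)) B =
        emeasure (distr M (F \<Otimes>\<^sub>M G) (\<lambda>\<omega>. (\<omega>, \<lambda>n. E n \<omega>))) (A \<times> B)"
      by (simp add: emeasure_distr A' B'_def[symmetric] emeasure_eq_measure ennreal_mult)
  qed (auto intro: P1.sigma_finite_measure_axioms P2.sigma_finite_measure_axioms)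
  have "(\<integral>\<^sup>+\<omega>. h (\<omega>, \<lambda>n. E n \<omega>) \<partial>M) = integral\<^sup>N (distr M (F \<Otimes>\<^sub>M G) (\<lambda>\<omega>. (\<omega>, \<lambda>n. E n \<omega>))) h"
    by (subst nn_integral_distr) measurable
  also have "\<dots> = (\<integral>\<^sup>+e. \<integral>\<^sup>+\<omega>. h (\<omega>, e) \<partial>distr M F (\<lambda>\<omega>. \<omega>) \<partial>distr M G (\<lambda>\<omega> n. E n \<omega>))"
    unfolding eq[symmetric] by (rule P.nn_integral_snd[symmetric]) measurable
  also have "\<dots> = (\<integral>\<^sup>+\<omega>'. \<integral>\<^sup>+\<omega>. h (\<omega>, \<lambda>n. E n \<omega>') \<partial>distr M F (\<lambda>\<omega>. \<omega>) \<partial>M)"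
    by (subst nn_integral_distr) measurable
  also have "\<dots> = (\<integral>\<^sup>+\<omega>'. \<integral>\<^sup>+\<omega>. h (\<omega>, \<lambda>n. E n \<omega>') \<partial>M \<partial>M)"
  proof (intro nn_integral_cong)
    fix \<omega>' assume "\<omega>' \<in> space M"
    then have "(\<lambda>n. E n \<omega>') \<in> space G" using measurable_space[OF E_G_measurable] by auto
    from measurable_compose[OF measurable_Pair2'[OF this] assms]
    show "(\<integral>\<^sup>+\<omega>. h (\<omega>, \<lambda>n. E n \<omega>') \<partial>distr M F (\<lambda>\<omega>. \<omega>)) = (\<integral>\<^sup>+\<omega>. h (\<omega>, \<lambda>n. E n \<omega>') \<partial>M)"
      by (intro nn_integral_distr[OF id_F_measurable]) simp
  qed
  finally show ?thesis .
qed


text \<open>\<open>left_lim \<le> Z\<close> pointwise, and by continuity of the Laplace exponent in time both sides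
  have the same expectation after applying \<open>x \<mapsto> exp (- x)\<close>.\<close>

lemma left_lim_eq_AE:
  "AE \<omega> in M. left_lim (\<lambda>y. D y \<omega>) x = Z x \<omega>"
proof (cases "x > 0")
  case False
  then have "max 0 (x - 1 / real (Suc m)) = 0" "max 0 x = 0" for m
    using max_diff_inverse_le[of x m] by auto
  then show ?thesis by (simp add: left_lim_def Z_def)
next
  case True
  define L where "L \<omega> = left_lim (\<lambda>y. D y \<omega>) x" for \<omega>
  have [measurable]: "L \<in> borel_measurable M" "Z x \<in> borel_measurable M"
    unfolding L_def by measurable
  have Lb: "0 \<le> L \<omega>" "0 \<le> Z x \<omega>" "L \<omega> \<le> Z x \<omega>" if "\<omega> \<in> space M" for \<omega>
    using left_lim_le[OF D_mono, OF that, of x] left_lim_upper[OF D_mono, OF that, of x 0]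
      D_nonneg[OF that, of "max 0 (x - 1 / real (Suc 0))"]
    by (auto simp: L_def Z_def)
  define d where "d \<omega> = exp (- L \<omega>) - exp (- Z x \<omega>)" for \<omega>
  have int: "integrable M (\<lambda>\<omega>. exp (- L \<omega>))" "integrable M (\<lambda>\<omega>. exp (- Z x \<omega>))"
    using Lb by (auto intro!: integrable_const_bound[where B = 1] AE_I2)
  have "expectation (\<lambda>\<omega>. exp (- L \<omega>)) \<le> exp (- (x - 1 / real (Suc m)) * \<psi> 1)" for m
  proof -
    define v where "v = max 0 (x - 1 / real (Suc m))"
    have v: "v \<ge> 0" by (simp add: v_def)
    note [measurable] = D_measurable[OF v]
    have "expectation (\<lambda>\<omega>. exp (- L \<omega>)) \<le> expectation (\<lambda>\<omega>. exp (- 1 * D v \<omega>))"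
    proof (rule integral_mono)
      show "integrable M (\<lambda>\<omega>. exp (- 1 * D v \<omega>))"
        using D_nonneg[OF _ v] by (auto intro!: integrable_const_bound[where B = 1] AE_I2)
      show "exp (- L \<omega>) \<le> exp (- 1 * D v \<omega>)" if "\<omega> \<in> space M" for \<omega>
        using left_lim_upper[OF D_mono, OF that, of x m] by (simp add: L_def v_def)
    qed (rule int)
    also have "\<dots> = exp (- v * \<psi> 1)"
      using v by (intro D_laplace) auto
    also have "\<dots> \<le> exp (- (x - 1 / real (Suc m)) * \<psi> 1)"
      using \<psi>_pos[of 1] unfolding v_def exp_le_cancel_iff by (intro mult_right_mono) auto
    finally show ?thesis .
  qed
  moreover have "(\<lambda>m. exp (- (x - 1 / real (Suc m)) * \<psi> 1)) \<longlonglongrightarrow> exp (- (x - 0) * \<psi> 1)"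
    using LIMSEQ_inverse_real_of_nat by (intro tendsto_intros) (simp add: inverse_eq_divide)
  ultimately have "expectation (\<lambda>\<omega>. exp (- L \<omega>)) \<le> exp (- (x - 0) * \<psi> 1)"
    by (intro LIMSEQ_le_const) auto
  also have "\<dots> = expectation (\<lambda>\<omega>. exp (- Z x \<omega>))"
    using True D_laplace[of 1 x] by (simp add: Z_def)
  finally have "expectation d \<le> 0"
    unfolding d_def using int by simp
  moreover have dn: "AE \<omega> in M. 0 \<le> d \<omega>"
    using Lb unfolding d_def by (intro AE_I2) auto
  ultimately have "expectation d = 0"
    using integral_nonneg_AE[OF dn] by simp
  moreover have "integrable M d"
    unfolding d_def using int by simp
  ultimately have "AE \<omega> in M. d \<omega> = 0"
    using integral_nonneg_eq_0_iff_AE[OF _ dn] by blast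
  then show ?thesis
    unfolding d_def L_def by eventually_elim simp
qed

text \<open>If \<open>A\<close> is the event that \<open>D\<close> stays at or below
  \<open>b\<close> at all integers, then \<open>exp (- b) * prob A\<close> is at most
  \<open>exp (- n * \<psi> 1)\<close> for every \<open>n\<close>. This removes the
  \<open>Inf {}\<close> branch almost surely.\<close>

lemma unbounded_AE: "AE \<omega> in M. \<forall>b::real. \<exists>n::nat. b < D (real n) \<omega>"
proof -
  have "AE \<omega> in M. \<exists>n::nat. real b < D (real n) \<omega>" for b :: nat
  proof -
    have [measurable]: "D (real n) \<in> borel_measurable M" for n
      by (rule D_measurable) simp
    define A where "A = {\<omega> \<in> space M. \<forall>n::nat. D (real n) \<omega> \<le> real b}"
    have [measurable]: "A \<in> events"
      unfolding A_def by measurable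
    have "exp (- real b) * prob A \<le> exp (- \<psi> 1) ^ n" for n
    proof -
      have "exp (- real b) * prob A = expectation (\<lambda>\<omega>. exp (- real b) * indicator A \<omega>)"
        by simp
      also have "\<dots> \<le> expectation (\<lambda>\<omega>. exp (- 1 * D (real n) \<omega>))"
      proof (rule integral_mono)
        show "integrable M (\<lambda>\<omega>. exp (- 1 * D (real n) \<omega>))"
          using D_nonneg by (auto intro!: integrable_const_bound[where B = 1] AE_I2)
        show "exp (- real b) * indicator A \<omega> \<le> exp (- 1 * D (real n) \<omega>)" if "\<omega> \<in> space M" for \<omega>
          using that by (auto simp: A_def indicator_def)
      qed (auto simp: emeasure_eq_measure intro!: integrable_real_indicator)
      also have "\<dots> = exp (- real n * \<psi> 1)"
        by (intro D_laplace) auto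
      also have "\<dots> = exp (- \<psi> 1) ^ n"
        by (simp add: exp_of_nat_mult[symmetric])
      finally show ?thesis .
    qed
    moreover have "(\<lambda>n. exp (- \<psi> 1) ^ n) \<longlonglongrightarrow> 0"
      using \<psi>_pos[of 1] by (intro LIMSEQ_realpow_zero) auto
    ultimately have "exp (- real b) * prob A \<le> 0"
      by (intro LIMSEQ_le_const) auto
    then have "prob A = 0"
      using measure_nonneg[of M A] by (simp add: mult_le_0_iff order_antisym)
    then have "AE \<omega> in M. \<omega> \<notin> A"
      by (subst (asm) prob_eq_0) auto
    then show ?thesis
      using AE_space by eventually_elim (auto simp: A_def not_le)
  qed
  then have "AE \<omega> in M. \<forall>b::nat. \<exists>n::nat. real b < D (real n) \<omega>"
    by (subst AE_all_countable) blast
  then show ?thesis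
  proof eventually_elim
    case (elim \<omega>)
    show ?case
    proof
      fix b :: real
      obtain c :: nat where "b < real c" using reals_Archimedean2 by blast
      with elim[rule_format, of c] show "\<exists>n. b < D (real n) \<omega>" by (meson less_trans)
    qed
  qed
qed

section \<open>Arrival times as values of the subordinator\<close>

text \<open>Keeping the \<open>Inf {}\<close> branch makes the formula valid at every outcome.
  Measurability follows from it; an almost sure identity would not give that, as \<open>M\<close>
  need not be complete.\<close>

lemma tc_arrival_time_eq:
  assumes "\<omega> \<in> space M" "n > 0"
  shows "tc_arrival_time D E n \<omega> =
    (if arrival_epoch E n \<omega> > Inf {} \<and> (\<forall>k::nat. Z (real k) \<omega> \<le> left_lim (\<lambda>y. D y \<omega>) (arrival_epoch E n \<omega>))
     then Inf {} else left_lim (\<lambda>y. D y \<omega>) (arrival_epoch E n \<omega>))"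
  using Inf_inverse_level[OF D_mono[OF assms(1)] D_zero[OF assms(1)], of "arrival_epoch E n \<omega>"] assms
  by (simp add: tc_arrival_time_def inv_sub_def Z_def)

lemma arrival_epoch_measurable [measurable]: "arrival_epoch E n \<in> borel_measurable M"
  unfolding arrival_epoch_def by measurable

lemma tc_arrival_time_measurable [measurable]: "tc_arrival_time D E n \<in> borel_measurable M"
proof (cases "n = 0")
  case True
  then show ?thesis by (simp add: tc_arrival_time_def[abs_def])
next
  case False
  then show ?thesis
    by (subst measurable_cong[OF tc_arrival_time_eq]) auto
qed

lemma tc_interarrival_measurable [measurable]: "tc_interarrival D E n \<in> borel_measurable M"
  unfolding tc_interarrival_def by measurable

text \<open>Once the epochs are frozen, \<open>left_lim_eq_AE\<close> applies at a deterministic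
  time; integrating over them shows that the exceptional event is null although the time is random.
  Unboundedness then selects the regular branch.\<close>

lemma tc_arrival_time_AE: "AE \<omega> in M. \<forall>n. tc_arrival_time D E n \<omega> = Z (arrival_epoch E n \<omega>) \<omega>"
proof -
  have "AE \<omega> in M. left_lim (\<lambda>y. D y \<omega>) (arrival_epoch E n \<omega>) = Z (arrival_epoch E n \<omega>) \<omega>" for n
  proof -
    define B where "B = {p \<in> space (F \<Otimes>\<^sub>M G). left_lim (\<lambda>y. D y (fst p)) (\<Sum>i<n. snd p i) \<noteq> Z (\<Sum>i<n. snd p i) (fst p)}"
    have [measurable]: "B \<in> sets (F \<Otimes>\<^sub>M G)"
      unfolding B_def by measurable
    have spG: "(\<lambda>n. E n \<omega>) \<in> space G" if "\<omega> \<in> space M" for \<omega>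
      using measurable_space[OF E_G_measurable that] .
    have "(\<integral>\<^sup>+\<omega>. indicator B (\<omega>, \<lambda>n. E n \<omega>) \<partial>M) = (\<integral>\<^sup>+\<omega>'. \<integral>\<^sup>+\<omega>. indicator B (\<omega>, \<lambda>n. E n \<omega>') \<partial>M \<partial>M)"
      by (rule nn_integral_split) measurable
    also have "\<dots> = (\<integral>\<^sup>+\<omega>'. 0 \<partial>M)"
    proof (rule nn_integral_cong)
      fix \<omega>' assume "\<omega>' \<in> space M"
      have "(\<integral>\<^sup>+\<omega>. indicator B (\<omega>, \<lambda>n. E n \<omega>') \<partial>M) = (\<integral>\<^sup>+\<omega>. 0 \<partial>M)"
        using left_lim_eq_AE[of "\<Sum>i<n. E i \<omega>'"] by (intro nn_integral_cong_AE) (auto elim!: eventually_mono simp: B_def)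
      then show "(\<integral>\<^sup>+\<omega>. indicator B (\<omega>, \<lambda>n. E n \<omega>') \<partial>M) = 0" by simp
    qed
    finally have "(\<integral>\<^sup>+\<omega>. indicator B (\<omega>, \<lambda>n. E n \<omega>) \<partial>M) = 0" by simp
    then have "AE \<omega> in M. indicator B (\<omega>, \<lambda>n. E n \<omega>) = (0::ennreal)"
      by (subst (asm) nn_integral_0_iff_AE) auto
    with AE_space show ?thesis
      by eventually_elim (auto simp: B_def space_pair_measure space_F spG arrival_epoch_def indicator_def split: if_splits)
  qed
  then have "AE \<omega> in M. \<forall>n. left_lim (\<lambda>y. D y \<omega>) (arrival_epoch E n \<omega>) = Z (arrival_epoch E n \<omega>) \<omega>"
    by (subst AE_all_countable) blast
  with unbounded_AE AE_space show ?thesis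
  proof eventually_elim
    case (elim \<omega>)
    show ?case
    proof
      fix n
      show "tc_arrival_time D E n \<omega> = Z (arrival_epoch E n \<omega>) \<omega>"
      proof (cases "n = 0")
        case True
        then show ?thesis using elim by (simp add: tc_arrival_time_def arrival_epoch_def Z_def D_zero)
      next
        case False
        obtain k :: nat where "Z (arrival_epoch E n \<omega>) \<omega> < D (real k) \<omega>"
          using elim by blast
        then have "\<not> (\<forall>k::nat. Z (real k) \<omega> \<le> left_lim (\<lambda>y. D y \<omega>) (arrival_epoch E n \<omega>))"
          using elim by (auto simp: Z_def not_le intro!: exI[of _ k])
        then show ?thesis
          using elim tc_arrival_time_eq[of \<omega> n] False by auto
      qed
    qed
  qed
qed

lemma tc_interarrival_AE:
  "AE \<omega> in M. \<forall>n. tc_interarrival D E n \<omega> = Z (\<Sum>i<Suc n. E i \<omega>) \<omega> - Z (\<Sum>i<n. E i \<omega>) \<omega>"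
  using tc_arrival_time_AE by eventually_elim (auto simp: tc_interarrival_def arrival_epoch_def)

section \<open>Joint law of the inter-arrival times\<close>

lemma E_nonneg_AE: "AE \<omega> in M. \<forall>n. 0 \<le> E n \<omega>"
proof (subst AE_all_countable, intro allI)
  fix n
  have "AE x in distr M lborel (E n). 0 \<le> x"
    unfolding distributed_distr_eq_density[OF E_distributed[of n]]
    by (subst AE_density) (auto simp: exponential_density_def)
  then show "AE \<omega> in M. 0 \<le> E n \<omega>"
    by (subst (asm) AE_distr_iff) auto
qed

text \<open>The law of the subordinator at an independent exponential time, as a mixture over that
  time.\<close>

definition law :: "real set \<Rightarrow> ennreal" where
  "law B = (\<integral>\<^sup>+\<omega>'. emeasure M {\<omega> \<in> space M. Z (E 0 \<omega>') \<omega> \<in> B} \<partial>M)"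

lemma emeasure_Z_measurable [measurable]:
  assumes [measurable]: "B \<in> sets borel"
  shows "(\<lambda>x. emeasure M {\<omega> \<in> space M. Z x \<omega> \<in> B}) \<in> borel_measurable borel"
proof -
  have "(\<lambda>x. \<integral>\<^sup>+\<omega>. indicator B (Z x \<omega>) \<partial>M) \<in> borel_measurable borel"
    by measurable
  also have "(\<lambda>x. \<integral>\<^sup>+\<omega>. indicator B (Z x \<omega>) \<partial>M) = (\<lambda>x. emeasure M {\<omega> \<in> space M. Z x \<omega> \<in> B})"
  proof
    fix x
    have "(\<integral>\<^sup>+\<omega>. indicator B (Z x \<omega>) \<partial>M) = (\<integral>\<^sup>+\<omega>. indicator {\<omega> \<in> space M. Z x \<omega> \<in> B} \<omega> \<partial>M)"
      by (intro nn_integral_cong) (auto simp: indicator_def)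
    then show "(\<integral>\<^sup>+\<omega>. indicator B (Z x \<omega>) \<partial>M) = emeasure M {\<omega> \<in> space M. Z x \<omega> \<in> B}"
      by simp
  qed
  finally show ?thesis .
qed

lemma law_eq:
  assumes [measurable]: "B \<in> sets borel"
  shows "(\<integral>\<^sup>+\<omega>'. emeasure M {\<omega> \<in> space M. Z (E n \<omega>') \<omega> \<in> B} \<partial>M) = law B"
proof -
  have "distr M lborel (E n) = distr M lborel (E 0)"
    by (simp add: distributed_distr_eq_density[OF E_distributed])
  then have "(\<integral>\<^sup>+x. emeasure M {\<omega> \<in> space M. Z x \<omega> \<in> B} \<partial>distr M lborel (E n)) =
     (\<integral>\<^sup>+x. emeasure M {\<omega> \<in> space M. Z x \<omega> \<in> B} \<partial>distr M lborel (E 0))"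
    by simp
  then show ?thesis
    unfolding law_def by (subst (asm) (1 2) nn_integral_distr) auto
qed

text \<open>For frozen spans the partial sums form a deterministic time grid: independent increments
  give the product, and stationarity reduces each factor to its own span.\<close>

lemma emeasure_increments:
  assumes e: "\<And>i. 0 \<le> e i" and B [measurable]: "\<And>i. B i \<in> sets borel"
  shows "emeasure M {\<omega> \<in> space M. \<forall>i<n. Z (\<Sum>j<Suc i. e j) \<omega> - Z (\<Sum>j<i. e j) \<omega> \<in> B i} =
    (\<Prod>i<n. emeasure M {\<omega> \<in> space M. Z (e i) \<omega> \<in> B i})"
proof (cases "n = 0")
  case True
  then show ?thesis by (simp add: emeasure_space_1)
next
  case False
  define s where "s i = (\<Sum>j<i. e j)" for i
  have s: "s i \<ge> 0" for i unfolding s_def by (intro sum_nonneg e)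
  have Zs: "Z (s i) = D (s i)" "Z (e i) = D (e i)" for i
    using s[of i] e[of i] by (auto simp: Z_def fun_eq_iff)
  note [measurable] = D_measurable[OF s] D_measurable[OF e]
  have I: "indep_vars (\<lambda>_. borel) (\<lambda>i \<omega>. D (s (Suc i)) \<omega> - D (s i) \<omega>) {..<n}"
    by (rule D_indep) (use e in \<open>auto simp: s_def\<close>)
  have eq: "prob ((\<lambda>\<omega>. D (s (Suc i)) \<omega> - D (s i) \<omega>) -` B i \<inter> space M) = prob {\<omega> \<in> space M. Z (e i) \<omega> \<in> B i}" for i
  proof -
    have "measure (distr M borel (\<lambda>\<omega>. D (s i + e i) \<omega> - D (s i) \<omega>)) (B i) = measure (distr M borel (D (e i))) (B i)"
      using D_stationary[OF s e] by simp
    moreover have "s i + e i = s (Suc i)" by (simp add: s_def)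
    ultimately show ?thesis
      by (simp add: measure_distr Zs vimage_def Int_def conj_commute)
  qed
  have "prob (\<Inter>i\<in>{..<n}. (\<lambda>\<omega>. D (s (Suc i)) \<omega> - D (s i) \<omega>) -` B i \<inter> space M) =
    (\<Prod>i<n. prob ((\<lambda>\<omega>. D (s (Suc i)) \<omega> - D (s i) \<omega>) -` B i \<inter> space M))"
    using False by (intro indep_varsD_finite[OF I]) auto
  also have "(\<Inter>i\<in>{..<n}. (\<lambda>\<omega>. D (s (Suc i)) \<omega> - D (s i) \<omega>) -` B i \<inter> space M) =
     {\<omega> \<in> space M. \<forall>i<n. Z (s (Suc i)) \<omega> - Z (s i) \<omega> \<in> B i}"
    using False by (auto simp: Zs)
  finally show ?thesis
    unfolding s_def[symmetric] emeasure_eq_measure by (simp only: eq) (simp add: prod_ennreal)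
qed

text \<open>After freezing, the conditional probability is a product whose \<open>i\<close>-th
  factor depends on \<open>E i\<close> alone, so independence of the spans moves the integral
  inside. Independence and the common law can both be read off.\<close>

lemma prob_interarrivals:
  assumes B [measurable]: "\<And>i. B i \<in> sets borel"
  shows "emeasure M {\<omega> \<in> space M. \<forall>i<n. tc_interarrival D E i \<omega> \<in> B i} = (\<Prod>i<n. law (B i))"
proof -
  define X where "X i p = Z (\<Sum>j<Suc i. snd p j) (fst p) - Z (\<Sum>j<i. snd p j) (fst p)" for i and p :: "'a \<times> (nat \<Rightarrow> real)"
  have [measurable]: "X i \<in> borel_measurable (F \<Otimes>\<^sub>M G)" for i
    unfolding X_def by measurable
  define A where "A = {p \<in> space (F \<Otimes>\<^sub>M G). \<forall>i<n. X i p \<in> B i}"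
  have [measurable]: "A \<in> sets (F \<Otimes>\<^sub>M G)"
    unfolding A_def by measurable
  have spG: "(\<lambda>n. E n \<omega>) \<in> space G" if "\<omega> \<in> space M" for \<omega>
    using measurable_space[OF E_G_measurable that] .
  have "emeasure M {\<omega> \<in> space M. \<forall>i<n. tc_interarrival D E i \<omega> \<in> B i} =
     (\<integral>\<^sup>+\<omega>. indicator {\<omega> \<in> space M. \<forall>i<n. tc_interarrival D E i \<omega> \<in> B i} \<omega> \<partial>M)"
    by (rule nn_integral_indicator[symmetric]) measurable
  also have "\<dots> = (\<integral>\<^sup>+\<omega>. indicator A (\<omega>, \<lambda>n. E n \<omega>) \<partial>M)"
  proof (rule nn_integral_cong_AE)
    show "AE \<omega> in M. (indicator {\<omega> \<in> space M. \<forall>i<n. tc_interarrival D E i \<omega> \<in> B i} \<omega> :: ennreal) = indicator A (\<omega>, \<lambda>n. E n \<omega>)"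
      using tc_interarrival_AE AE_space
      by eventually_elim (auto simp: A_def X_def space_pair_measure space_F spG indicator_def)
  qed
  also have "\<dots> = (\<integral>\<^sup>+\<omega>'. \<integral>\<^sup>+\<omega>. indicator A (\<omega>, \<lambda>n. E n \<omega>') \<partial>M \<partial>M)"
    by (rule nn_integral_split) measurable
  also have "\<dots> = (\<integral>\<^sup>+\<omega>'. (\<Prod>i<n. emeasure M {\<omega> \<in> space M. Z (E i \<omega>') \<omega> \<in> B i}) \<partial>M)"
  proof (rule nn_integral_cong_AE)
    show "AE \<omega>' in M. (\<integral>\<^sup>+\<omega>. indicator A (\<omega>, \<lambda>n. E n \<omega>') \<partial>M) = (\<Prod>i<n. emeasure M {\<omega> \<in> space M. Z (E i \<omega>') \<omega> \<in> B i})"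
      using E_nonneg_AE AE_space
    proof eventually_elim
      case (elim \<omega>')
      have "(\<integral>\<^sup>+\<omega>. indicator A (\<omega>, \<lambda>n. E n \<omega>') \<partial>M) =
        (\<integral>\<^sup>+\<omega>. indicator {\<omega> \<in> space M. \<forall>i<n. Z (\<Sum>j<Suc i. E j \<omega>') \<omega> - Z (\<Sum>j<i. E j \<omega>') \<omega> \<in> B i} \<omega> \<partial>M)"
        using elim by (intro nn_integral_cong) (auto simp: A_def X_def space_pair_measure space_F spG indicator_def)
      also have "\<dots> = emeasure M {\<omega> \<in> space M. \<forall>i<n. Z (\<Sum>j<Suc i. E j \<omega>') \<omega> - Z (\<Sum>j<i. E j \<omega>') \<omega> \<in> B i}"
        by (rule nn_integral_indicator) measurable
      also have "\<dots> = (\<Prod>i<n. emeasure M {\<omega> \<in> space M. Z (E i \<omega>') \<omega> \<in> B i})"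
        using elim by (intro emeasure_increments) auto
      finally show ?case .
    qed
  qed
  also have "\<dots> = (\<Prod>i<n. \<integral>\<^sup>+\<omega>'. emeasure M {\<omega> \<in> space M. Z (E i \<omega>') \<omega> \<in> B i} \<partial>M)"
    by (intro indep_vars_nn_integral indep_vars_compose2[OF indep_vars_subset[OF E_indep]]) auto
  also have "\<dots> = (\<Prod>i<n. law (B i))"
    by (simp add: law_eq)
  finally show ?thesis .
qed

lemma law_UNIV: "law UNIV = 1"
  by (simp add: law_def emeasure_space_1)

lemma emeasure_interarrival:
  assumes [measurable]: "B \<in> sets borel"
  shows "emeasure M {\<omega> \<in> space M. tc_interarrival D E n \<omega> \<in> B} = law B"
proof -
  have "emeasure M {\<omega> \<in> space M. \<forall>i<Suc n. tc_interarrival D E i \<omega> \<in> (if i = n then B else UNIV)} = (\<Prod>i<Suc n. law (if i = n then B else UNIV))"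
    by (rule prob_interarrivals) auto
  also have "\<dots> = (\<Prod>i<n. law (if i = n then B else UNIV)) * law B"
    by simp
  also have "(\<Prod>i<n. law (if i = n then B else UNIV)) = 1"
    by (rule prod.neutral) (auto simp: law_UNIV)
  also have "{\<omega> \<in> space M. \<forall>i<Suc n. tc_interarrival D E i \<omega> \<in> (if i = n then B else UNIV)} = {\<omega> \<in> space M. tc_interarrival D E n \<omega> \<in> B}"
    by auto
  finally show ?thesis by simp
qed

lemma distr_interarrival: "distr M borel (tc_interarrival D E n) = distr M borel (tc_interarrival D E 0)"
proof (rule measure_eqI)
  fix B assume "B \<in> sets (distr M borel (tc_interarrival D E n))"
  then have [measurable]: "B \<in> sets borel" by simp
  show "emeasure (distr M borel (tc_interarrival D E n)) B = emeasure (distr M borel (tc_interarrival D E 0)) B"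
    using emeasure_interarrival[of B n] emeasure_interarrival[of B 0]
    by (simp add: emeasure_distr vimage_def Int_def conj_commute)
qed simp

lemma indep_interarrivals: "indep_vars (\<lambda>_. borel) (tc_interarrival D E) UNIV"
  unfolding indep_vars_def2
proof (intro conjI ballI indep_setsI)
  fix A J assume J: "J \<noteq> {}" "finite (J :: nat set)"
    and "\<forall>j\<in>J. A j \<in> {tc_interarrival D E j -` B \<inter> space M |B. B \<in> sets borel}"
  then have "\<forall>j. \<exists>B. j \<in> J \<longrightarrow> B \<in> sets borel \<and> A j = tc_interarrival D E j -` B \<inter> space M"
    by blast
  then obtain B where B: "\<And>j. j \<in> J \<Longrightarrow> B j \<in> sets borel" "\<And>j. j \<in> J \<Longrightarrow> A j = tc_interarrival D E j -` B j \<inter> space M"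
    by metis
  obtain n where n: "J \<subseteq> {..<n}"
    using J(2) by (auto simp: finite_nat_iff_bounded)
  \<comment> \<open>Padding with \<open>UNIV\<close>, of law 1, extends \<open>J\<close> to an
    initial segment of indices.\<close>
  define C where "C j = (if j \<in> J then B j else UNIV)" for j
  have C [measurable]: "C j \<in> sets borel" for j using B by (auto simp: C_def)
  have "emeasure M {\<omega> \<in> space M. \<forall>i<n. tc_interarrival D E i \<omega> \<in> C i} = (\<Prod>i<n. law (C i))"
    by (rule prob_interarrivals) (rule C)
  also have "\<dots> = (\<Prod>j\<in>J. law (C j))"
    using n by (intro prod.mono_neutral_right) (auto simp: C_def law_UNIV)
  also have "\<dots> = (\<Prod>j\<in>J. emeasure M (A j))"
    using emeasure_interarrival[OF B(1)] B(2)
    by (intro prod.cong refl) (auto simp: C_def vimage_def Int_def conj_commute)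
  also have "\<dots> = ennreal (\<Prod>j\<in>J. prob (A j))"
    by (simp add: emeasure_eq_measure prod_ennreal)
  also have "{\<omega> \<in> space M. \<forall>i<n. tc_interarrival D E i \<omega> \<in> C i} = (\<Inter>j\<in>J. A j)"
    using J n by (auto simp: C_def B(2) split: if_splits)
  finally show "prob (\<Inter>j\<in>J. A j) = (\<Prod>j\<in>J. prob (A j))"
    by (simp add: emeasure_eq_measure prod_nonneg)
qed auto

section \<open>Laplace transform and survival function of an inter-arrival time\<close>

lemma laplace_interarrival:
  assumes s: "s \<ge> 0"
  shows "expectation (\<lambda>\<omega>. exp (- s * tc_interarrival D E 0 \<omega>)) = lam / (lam + \<psi> s)"
proof -
  have \<psi>0: "\<psi> s \<ge> 0" using s \<psi>_pos[of s] by (cases "s = 0") (auto simp: \<psi>_def)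
  have "(\<integral>\<^sup>+\<omega>. ennreal (exp (- s * tc_interarrival D E 0 \<omega>)) \<partial>M) =
    (\<integral>\<^sup>+\<omega>. (\<lambda>p. ennreal (exp (- s * Z (snd p 0) (fst p)))) (\<omega>, \<lambda>n. E n \<omega>) \<partial>M)"
    using tc_interarrival_AE AE_space
    by (intro nn_integral_cong_AE, eventually_elim) (auto simp: Z_def D_zero)
  also have "\<dots> = (\<integral>\<^sup>+\<omega>'. \<integral>\<^sup>+\<omega>. (\<lambda>p. ennreal (exp (- s * Z (snd p 0) (fst p)))) (\<omega>, \<lambda>n. E n \<omega>') \<partial>M \<partial>M)"
    by (rule nn_integral_split) measurable
  also have "\<dots> = (\<integral>\<^sup>+\<omega>'. ennreal (exp (- max 0 (E 0 \<omega>') * \<psi> s)) \<partial>M)"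
  proof (rule nn_integral_cong)
    fix \<omega>'
    define x where "x = max 0 (E 0 \<omega>')"
    have x: "x \<ge> 0" by (simp add: x_def)
    note [measurable] = D_measurable[OF x]
    have "(\<integral>\<^sup>+\<omega>. ennreal (exp (- s * D x \<omega>)) \<partial>M) = ennreal (expectation (\<lambda>\<omega>. exp (- s * D x \<omega>)))"
      using D_nonneg[OF _ x] s
      by (intro nn_integral_eq_integral integrable_const_bound[where B = 1]) (auto intro!: AE_I2)
    then show "(\<integral>\<^sup>+\<omega>. (\<lambda>p. ennreal (exp (- s * Z (snd p 0) (fst p)))) (\<omega>, \<lambda>n. E n \<omega>') \<partial>M) = ennreal (exp (- max 0 (E 0 \<omega>') * \<psi> s))"
      using D_laplace[OF s x] by (simp add: Z_def x_def)
  qed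
  also have "\<dots> = (\<integral>\<^sup>+x. ennreal (exponential_density lam x) * ennreal (exp (- max 0 x * \<psi> s)) \<partial>lborel)"
    using distributed_nn_integral[OF E_distributed[of 0], of "\<lambda>x. ennreal (exp (- max 0 x * \<psi> s))"] by simp
  \<comment> \<open>The exponential density vanishes on negative times, so the clamp disappears and
    the rates add up.\<close>
  also have "\<dots> = (\<integral>\<^sup>+x. ennreal (lam * (indicator {0..} x *\<^sub>R exp (- (lam + \<psi> s) * x))) \<partial>lborel)"
    using lam by (intro nn_integral_cong)
      (auto simp: exponential_density_def indicator_def max_def algebra_simps mult_exp_exp ennreal_mult'[symmetric])
  also have "\<dots> = ennreal (lam / (lam + \<psi> s))"
    using laplace_exp[of "lam + \<psi> s"] lam \<psi>0
    by (subst nn_integral_eq_integral) (auto simp: set_integrable_def set_lebesgue_integral_def intro!: AE_I2)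
  finally show ?thesis
    using lam \<psi>0 by (intro integral_eq_nn_integral[THEN trans]) (auto intro!: AE_I2)
qed

lemma survival_interarrival:
  assumes "t \<ge> 0"
  shows "prob {\<omega> \<in> space M. tc_interarrival D E 0 \<omega> > t} = exp (- \<theta> * t) * tail_series lam \<theta> \<alpha> t"
proof -
  define X where "X = tc_interarrival D E 0"
  define S where "S t = prob {\<omega> \<in> space M. X \<omega> > t}" for t
  define K where "K = tail_series lam \<theta> \<alpha>"
  have [measurable]: "X \<in> borel_measurable M" unfolding X_def by measurable
  have X: "AE \<omega> in M. 0 \<le> X \<omega>"
    using tc_interarrival_AE AE_space
  proof eventually_elim
    case (elim \<omega>)
    then show ?case
      using D_nonneg[of \<omega> "max 0 (E 0 \<omega>)"] by (simp add: X_def Z_def D_zero)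
  qed
  \<comment> \<open>The first entry ensures \<open>w > \<theta>\<close>, the second
    \<open>w powr \<alpha> \<ge> lam + \<theta> powr \<alpha> + 1\<close>.\<close>
  define w where "w = max (\<theta> + 1) ((lam + \<theta> powr \<alpha> + 1) powr (1 / \<alpha>))"
  have w: "\<theta> < w" by (simp add: w_def)
  have "lam + \<theta> powr \<alpha> + 1 = ((lam + \<theta> powr \<alpha> + 1) powr (1 / \<alpha>)) powr \<alpha>"
    using lam \<alpha> by (simp add: powr_powr add_nonneg_nonneg)
  also have "\<dots> \<le> w powr \<alpha>"
    using \<alpha> by (intro powr_mono2) (auto simp: w_def)
  finally have "lam < w powr \<alpha> - \<theta> powr \<alpha>" by simp
  then obtain b where L: "laplace_dom w K b
    (\<lambda>u. 1 / (u - \<theta>) * ((u powr \<alpha> - \<theta> powr \<alpha>) / (lam + (u powr \<alpha> - \<theta> powr \<alpha>))))"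
    using laplace_dom_tail_series[OF \<alpha> lam \<theta> w] unfolding K_def by blast
  define v where "v = w + 1"
  \<comment> \<open>This is \<open>K t - exp (\<theta> * t) * S t\<close> damped by
    \<open>exp (- v * t)\<close>, so that both parts are integrable. An extra
    \<open>exp (- n * t)\<close> evaluates the transform of \<open>S\<close> at
    \<open>s = v - \<theta> + n\<close> and that of \<open>K\<close> at
    \<open>s + \<theta> > w\<close>.\<close>
  define h where "h t = exp (- v * t) * K t - exp (- (v - \<theta>) * t) * S t" for t
  have Kint: "set_integrable lborel {0..} (\<lambda>t. exp (- u * t) * K t)" if "u > w" for u
    using L that unfolding laplace_dom_def
    by (intro set_integrable_exp_bound[OF laplace_dom_measurable[OF L], of b w]) auto
  have Sint: "set_integrable lborel {0..} (\<lambda>t. exp (- s * t) * S t)" if "s > 0" for s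
    unfolding S_def by (rule laplace_survival(1)[OF _ X that]) measurable
  have "h t = 0"
  proof (rule Lerch[of h])
    show "set_integrable lborel {0..} h"
      unfolding h_def[abs_def] using w by (intro set_integral_diff(1) Kint Sint) (auto simp: v_def)
  next
    fix n :: nat
    define s where "s = v - \<theta> + real n"
    have s: "s > 0" using w by (simp add: s_def v_def)
    have "(LINT t:{0..}|lborel. exp (- real n * t) * h t) =
        (LINT t:{0..}|lborel. exp (- (s + \<theta>) * t) * K t - exp (- s * t) * S t)"
    proof (intro set_lebesgue_integral_cong allI impI)
      fix t :: real
      have "exp (- real n * t) * exp (- v * t) = exp (- (s + \<theta>) * t)"
        "exp (- real n * t) * exp (- (v - \<theta>) * t) = exp (- s * t)"
        unfolding mult_exp_exp s_def by (simp_all add: algebra_simps)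
      then show "exp (- real n * t) * h t = exp (- (s + \<theta>) * t) * K t - exp (- s * t) * S t"
        unfolding h_def right_diff_distrib mult.assoc[symmetric] by simp
    qed simp
    also have "\<dots> = (LINT t:{0..}|lborel. exp (- (s + \<theta>) * t) * K t) - (LINT t:{0..}|lborel. exp (- s * t) * S t)"
      by (intro set_integral_diff(2) Kint Sint s) (simp add: s_def v_def)
    also have "(LINT t:{0..}|lborel. exp (- (s + \<theta>) * t) * K t) = 1 / s * (\<psi> s / (lam + \<psi> s))"
    proof -
      have "s + \<theta> > w" by (simp add: s_def v_def)
      then have "(LINT t:{0..}|lborel. exp (- (s + \<theta>) * t) * K t) = 1 / (s + \<theta> - \<theta>) *
          (((s + \<theta>) powr \<alpha> - \<theta> powr \<alpha>) / (lam + ((s + \<theta>) powr \<alpha> - \<theta> powr \<alpha>)))"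
        using L unfolding laplace_dom_def by blast
      then show ?thesis by (simp add: \<psi>_def)
    qed
    also have "(LINT t:{0..}|lborel. exp (- s * t) * S t) = (1 - lam / (lam + \<psi> s)) / s"
      unfolding S_def using laplace_interarrival[of s] s
      by (subst laplace_survival(2)[OF _ X s]) (simp_all add: X_def)
    also have "1 / s * (\<psi> s / (lam + \<psi> s)) - (1 - lam / (lam + \<psi> s)) / s = 0"
      using \<psi>_pos[OF s] lam s by (simp add: field_simps)
    finally show "(LINT t:{0..}|lborel. exp (- real n * t) * h t) = 0" .
  next
    fix t :: real assume t: "t \<ge> 0"
    have "continuous (at t within {0..}) K"
      using L t unfolding laplace_dom_def by (simp add: continuous_on_eq_continuous_within)
    then have "continuous (at_right t) K"
      by (rule continuous_within_subset) (use t in auto)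
    moreover have "continuous (at_right t) S"
      unfolding S_def[abs_def] by (rule survival_right_continuous) measurable
    ultimately show "continuous (at_right t) h"
      unfolding h_def[abs_def] by (intro continuous_intros)
  qed (rule assms)
  then have "exp (v * t) * (exp (- (v - \<theta>) * t) * S t) = exp (v * t) * (exp (- v * t) * K t)"
    by (simp add: h_def)
  then have "exp (\<theta> * t) * S t = K t"
    by (simp add: mult_exp_exp algebra_simps flip: mult.assoc)
  then have "S t = exp (- \<theta> * t) * K t"
    by (simp add: exp_minus field_simps)
  then show ?thesis by (simp add: S_def X_def K_def)
qed

end

theorem theorem4p3:
  fixes M :: "'a measure" and k :: nat and lam \<mu> \<theta> \<alpha> :: real
    and E :: "nat \<Rightarrow> 'a \<Rightarrow> real" and D :: "real \<Rightarrow> 'a \<Rightarrow> real"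
  assumes "prob_space M"
    and "k \<ge> 1" and "lam > 0" and "\<mu> > 0" and "\<theta> > 0" and "0 < \<alpha>" and "\<alpha> < 1"
    and "prob_space.indep_vars M (\<lambda>_. borel) E UNIV"
    and "\<And>n. distributed M lborel (E n) (exponential_density lam)"
    and "tempered_stable_subordinator M \<theta> \<alpha> D"
    and "prob_space.indep_set M
           (sets (vimage_algebra (space M) (\<lambda>\<omega>. restrict (\<lambda>x. D x \<omega>) {0::real..})
                   (PiM {0::real..} (\<lambda>_. borel))))
           (sets (vimage_algebra (space M) (\<lambda>\<omega> n. E n \<omega>) (PiM UNIV (\<lambda>_. borel))))"
  shows "prob_space.indep_vars M (\<lambda>_. borel) (tc_interarrival D E) UNIV
    \<and> (\<forall>n. distr M borel (tc_interarrival D E n) = distr M borel (tc_interarrival D E 0))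
    \<and> (\<forall>n. \<forall>t\<ge>0. measure M {\<omega> \<in> space M. tc_interarrival D E n \<omega> > t}
          = exp (- \<theta> * t) * (\<Sum>q. (\<theta> * t) ^ q *
              (\<Sum>r. (- lam * t powr \<alpha>) ^ r *
                 ML3 \<alpha> (real r * \<alpha> + real q + 1) (real r) (\<theta> powr \<alpha> * t powr \<alpha>))))"
proof -
  interpret subordinated_arrivals M lam \<theta> \<alpha> E D
    unfolding subordinated_arrivals_def subordinated_arrivals_axioms_def using assms by blast
  have "measure M {\<omega> \<in> space M. tc_interarrival D E n \<omega> > t} = exp (- \<theta> * t) * tail_series lam \<theta> \<alpha> t"
    if t: "t \<ge> 0" for n t
  proof -
    have "measure M {\<omega> \<in> space M. tc_interarrival D E n \<omega> > t} = measure M {\<omega> \<in> space M. tc_interarrival D E 0 \<omega> > t}"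
      using emeasure_interarrival[of "{t<..}" n] emeasure_interarrival[of "{t<..}" 0]
      by (simp add: measure_def)
    then show ?thesis using survival_interarrival[OF t] by simp
  qed
  with indep_interarrivals distr_interarrival show ?thesis
    unfolding tail_series_def by blast
qed

end
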